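(* Let $\lambda,R>0$. For line percolation in the occupied set $\mathcal{B}$, the decay exponent $\alpha$ is the unique solution of the equation $$1=\int_0^{2R} e^{\alpha t}\,H_{R,\lambda}'(t)\,dt,$$ where $$H_{R,\lambda}(t):=-\exp\left(-4\lambda\int_0^{t/2}\sinh\left(\cosh^{-1}\left(\frac{\cosh R}{\cosh s}\right)\right)ds\right).$$
   Context: $X$ is a Poisson point process of intensity $\lambda$ (with respect to hyperbolic area) in the hyperbolic plane $\mathbb{H}^2$, and $\mathcal{B}:=\bigcup_{x\in X}\overline{B(x,R)}$, where $B(x,r)$ is the open ball of radius $r$ about $x$. Let $f(r)$ be the probability that a fixed geodesic line segment of length $r$ in $\mathbb{H}^2$ is contained in $\mathcal{B}$. There is a unique $\alpha\ge 0$ (depending on $\lambda,R$) for which there is a constant $c>0$ with $c\,e^{-\alpha r}\le f(r)\le e^{-\alpha r}$ for all $r\ge0$; this $\alpha$ is the decay exponent for $\mathcal{B}$. Here $\cosh^{-1}$ denotes the nonnegative inverse of $\cosh$. *)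

theory Defs
  imports "HOL-Probability.Probability"
begin

section \<open>The hyperbolic plane (upper half-plane model, curvature $-1$)\<close>

definition hplane :: "complex set" where
  "hplane = {z. Im z > 0}"

definition hdist :: "complex \<Rightarrow> complex \<Rightarrow> real" where
  "hdist z w = arcosh (1 + (cmod (z - w))\<^sup>2 / (2 * Im z * Im w))"

definition hball :: "complex \<Rightarrow> real \<Rightarrow> complex set" where
  "hball x r = {y \<in> hplane. hdist x y < r}"

definition harea :: "complex measure" where
  "harea = density (restrict_space lborel hplane) (\<lambda>z. ennreal (1 / (Im z)\<^sup>2))"

definition geodesic_segment :: "real \<Rightarrow> complex set \<Rightarrow> bool" where
  "geodesic_segment r S \<longleftrightarrow>
     (\<exists>\<gamma>. S = \<gamma> ` {0..r} \<and> \<gamma> ` {0..r} \<subseteq> hplane \<and>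
          (\<forall>s\<in>{0..r}. \<forall>t\<in>{0..r}. hdist (\<gamma> s) (\<gamma> t) = \<bar>s - t\<bar>))"


section \<open>Poisson point process and occupied set\<close>

text \<open>Since hyperbolic area has no atoms, the process is simple and is represented by its random
  set of points, locally finite for every outcome. The Poisson law is written out because
  \<^const>\<open>poisson_pmf\<close> is only specified for positive rates, whereas sets of area 0 also occur here.
  A set of finite but unbounded area may meet \<open>X \<omega>\<close> in infinitely many points (where
  \<^const>\<open>card\<close> is 0) only for a null set of \<open>\<omega>\<close>.\<close>

definition poisson_process :: "'w measure \<Rightarrow> ('w \<Rightarrow> complex set) \<Rightarrow> real \<Rightarrow> bool" where
  "poisson_process M X l \<longleftrightarrow>
     prob_space M \<and>
     (\<forall>\<omega>\<in>space M. X \<omega> \<subseteq> hplane \<and> (\<forall>x\<in>hplane. \<forall>r. finite (X \<omega> \<inter> hball x r))) \<and>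
     (\<forall>A\<in>sets harea. emeasure harea A < \<infinity> \<longrightarrow>
        (\<lambda>\<omega>. card (X \<omega> \<inter> A)) \<in> measurable M (count_space UNIV) \<and>
        (\<forall>n. measure M {\<omega> \<in> space M. card (X \<omega> \<inter> A) = n} =
             (l * measure harea A) ^ n / fact n * exp (- (l * measure harea A)))) \<and>
     (\<forall>A :: nat \<Rightarrow> complex set.
        disjoint_family A \<and> (\<forall>i. A i \<in> sets harea \<and> emeasure harea (A i) < \<infinity>) \<longrightarrow>
        prob_space.indep_vars M (\<lambda>_. count_space UNIV) (\<lambda>i \<omega>. card (X \<omega> \<inter> A i)) UNIV)"

text \<open>The closure is taken in \<^typ>\<open>complex\<close>; hyperbolic balls are relatively compact in the
  half-plane and both topologies agree there, so this is also the hyperbolic closure.\<close>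

definition occupied :: "complex set \<Rightarrow> real \<Rightarrow> complex set" where
  "occupied P R = (\<Union>x\<in>P. closure (hball x R))"

definition cover_prob :: "'w measure \<Rightarrow> ('w \<Rightarrow> complex set) \<Rightarrow> real \<Rightarrow> complex set \<Rightarrow> real" where
  "cover_prob M X R S = measure M {\<omega> \<in> space M. S \<subseteq> occupied (X \<omega>) R}"

text \<open>By isometry invariance \<^const>\<open>cover_prob\<close> depends on a segment only through its length \<open>r\<close>
  (this is \<open>f(r)\<close>), so the bounds are stated for all segments of length \<open>r\<close>.\<close>

definition is_decay_exponent ::
    "'w measure \<Rightarrow> ('w \<Rightarrow> complex set) \<Rightarrow> real \<Rightarrow> real \<Rightarrow> bool" where
  "is_decay_exponent M X R \<alpha> \<longleftrightarrow>
     \<alpha> \<ge> 0 \<and>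
     (\<exists>c>0. \<forall>r\<ge>0. \<forall>S. geodesic_segment r S \<longrightarrow>
        c * exp (- \<alpha> * r) \<le> cover_prob M X R S \<and>
        cover_prob M X R S \<le> exp (- \<alpha> * r))"

definition H :: "real \<Rightarrow> real \<Rightarrow> real \<Rightarrow> real" where
  "H R l t = - exp (- 4 * l * integral {0..t/2} (\<lambda>s. sinh (arcosh (cosh R / cosh s))))"

text \<open>\<^term>\<open>H R l\<close> is the paper's function only on \<open>[0, 2R]\<close>; its derivative is taken as a two-sided
  one, which is meaningful on the interior. The endpoints do not affect the integral.\<close>

definition exponent_equation :: "real \<Rightarrow> real \<Rightarrow> real \<Rightarrow> bool" where
  "exponent_equation R l \<alpha> \<longleftrightarrow>
     1 = integral {0..2 * R} (\<lambda>t. exp (\<alpha> * t) * deriv (H R l) t)"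

end

theory Submission
  imports Defs
begin

text \<open>
Only segments of one geodesic matter, here the imaginary axis with its unit speed
parametrisation \<open>t \<mapsto> i e\<^sup>t\<close>. A closed ball of radius \<open>R\<close> meets it in an interval, so the question is
when a Poisson family of random intervals covers \<open>[0, r]\<close>. In Fermi coordinates around the axis
the area of the centres whose ball contains the point at \<open>r\<close> but not the one at \<open>r - \<tau>\<close> is
\<open>\<integral>\<^sub>0\<^sup>\<tau> 2 sinh (arcosh (cosh R / cosh (v/2))) dv\<close> for \<open>\<tau> \<le> 2R\<close> and constant beyond, see
\<open>emeasure_axis_ball_diff\<close>. Hence \<open>- H\<close> at \<open>\<tau>\<close> is the probability that no interval covering
\<open>r\<close> starts after \<open>r - \<tau>\<close>; in other words \<open>H'\<close> is the density of the age \<open>\<tau>\<close> of the youngest interval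
covering \<open>r\<close>, the one with the rightmost left endpoint.

Condition on that age. The youngest interval covers \<open>[r - \<tau>, r]\<close>, and whether \<open>[0, r - \<tau>]\<close> is
covered depends only on intervals starting to the left of \<open>r - \<tau>\<close>, which are independent of the age.
So the covering probability \<open>f\<close> satisfies \<open>f(r) = \<integral>\<^sub>0\<^sup>2\<^sup>R f(r - t) H'(t) dt\<close> with \<open>f = 1\<close> on the
negative half-line. Solutions of this equation decay like \<open>e\<^sup>-\<^sup>\<alpha>\<^sup>r\<close> for the \<open>\<alpha>\<close> at which
\<open>e\<^sup>\<alpha>\<^sup>t H'(t)\<close> has total mass 1.

To avoid conditioning on null events, the age is only observed up to a mesh \<open>h\<close>, which turns the
equation into the two inequalities \<open>renewal_upper\<close> and \<open>renewal_lower\<close>. Their kernels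
differ by a shift of \<open>h\<close>, and summing \<open>e\<^sup>\<beta>\<^sup>t\<close> against them brackets the integral
\<open>tilted_mass\<close> up to a factor \<open>e\<^sup>\<beta>\<^sup>h\<close>. An induction along the mesh then shows that the
decay exponent is at least every \<open>\<beta> \<ge> 0\<close> of tilted mass below 1 and at most every \<open>\<beta> \<ge> 0\<close> of
tilted mass above 1. The tilted mass varies continuously, so it is 1 at the exponent, and it is
strictly increasing, which gives uniqueness.
\<close>

section \<open>Balls meeting a geodesic\<close>

definition axis_point :: "real \<Rightarrow> complex" where
  "axis_point t = Complex 0 (exp t)"

definition axis_ball :: "real \<Rightarrow> real \<Rightarrow> complex set" where
  "axis_ball R t = {z \<in> hplane. hdist z (axis_point t) \<le> R}"

text \<open>The formula is the Pythagorean theorem \<open>cosh d = cosh \<rho> cosh (t - s)\<close>: the foot of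
the perpendicular from \<open>z\<close> to the axis is the point at \<open>s = ln |z|\<close>, and its length
\<open>\<rho>\<close> satisfies \<open>cosh \<rho> = |z| / Im z\<close>.\<close>

lemma hdist_axis:
  assumes "z \<in> hplane"
  shows "hdist z (axis_point t) = arcosh (cmod z / Im z * cosh (t - ln (cmod z)))"
proof -
  have y: "Im z > 0" using assms by (simp add: hplane_def)
  then have z: "cmod z > 0" by auto
  have "1 + (cmod (z - axis_point t))\<^sup>2 / (2 * Im z * Im (axis_point t)) =
        ((cmod z)\<^sup>2 + (exp t)\<^sup>2) / (2 * Im z * exp t)"
    using y by (simp add: axis_point_def cmod_power2 power2_diff field_simps)
  also have "\<dots> = cmod z / Im z * cosh (t - ln (cmod z))"
    using y z by (simp add: cosh_def exp_diff exp_minus field_simps power2_eq_square)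
  finally show ?thesis by (simp add: hdist_def)
qed

lemma arcosh_le_iff_cosh:
  fixes x :: real assumes "x \<ge> 1" "r \<ge> 0"
  shows "arcosh x \<le> r \<longleftrightarrow> x \<le> cosh r" "arcosh x < r \<longleftrightarrow> x < cosh r"
proof -
  have "arcosh x \<le> r \<longleftrightarrow> cosh (arcosh x) \<le> cosh r"
    using assms by (subst cosh_real_nonneg_le_iff) auto
  then show "arcosh x \<le> r \<longleftrightarrow> x \<le> cosh r" using assms by simp
  have "arcosh x < r \<longleftrightarrow> cosh (arcosh x) < cosh r"
    using assms by (subst cosh_real_nonneg_less_iff) auto
  then show "arcosh x < r \<longleftrightarrow> x < cosh r" using assms by simp
qed

lemma cmod_div_Im_ge_1: "z \<in> hplane \<Longrightarrow> cmod z / Im z \<ge> 1"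
  using abs_Im_le_cmod[of z] by (simp add: hplane_def)

lemma cosh_dist_ge_1: "z \<in> hplane \<Longrightarrow> cmod z / Im z * cosh u \<ge> 1"
  using mult_mono[OF cmod_div_Im_ge_1[of z] cosh_real_ge_1[of u]] cmod_div_Im_ge_1[of z] by simp

lemma mem_axis_ball:
  assumes "R \<ge> 0"
  shows "z \<in> axis_ball R t \<longleftrightarrow> z \<in> hplane \<and> cmod z / Im z * cosh (t - ln (cmod z)) \<le> cosh R"
  using assms cosh_dist_ge_1[of z "t - ln (cmod z)"]
  by (auto simp: axis_ball_def hdist_axis arcosh_le_iff_cosh)

lemma axis_ball_interval:
  assumes "R \<ge> 0" "z \<in> axis_ball R p" "z \<in> axis_ball R r" "p \<le> q" "q \<le> r"
  shows "z \<in> axis_ball R q"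
proof -
  define s where "s = ln (cmod z)"
  have z: "z \<in> hplane" using assms(1,2) by (simp add: mem_axis_ball)
  have "cosh (q - s) \<le> max (cosh (p - s)) (cosh (r - s))"
  proof (cases "q \<ge> s")
    case True
    then have "cosh (q - s) \<le> cosh (r - s)" using assms by (subst cosh_real_nonneg_le_iff) auto
    then show ?thesis by simp
  next
    case False
    then have "cosh (q - s) \<le> cosh (p - s)" using assms by (subst cosh_real_nonpos_le_iff) auto
    then show ?thesis by simp
  qed
  then have "cmod z / Im z * cosh (q - s) \<le> cmod z / Im z * max (cosh (p - s)) (cosh (r - s))"
    using cmod_div_Im_ge_1[OF z] by (intro mult_left_mono) auto
  also have "\<dots> \<le> cosh R"
    using assms(1-3) by (auto simp: mem_axis_ball s_def max_def)
  finally show ?thesis using z assms(1) by (simp add: mem_axis_ball s_def)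
qed

text \<open>Both points lie within \<open>R\<close> of the foot of the perpendicular from a common
element.\<close>

lemma axis_ball_far:
  assumes "R \<ge> 0" "r - p > 2 * R"
  shows "axis_ball R p \<inter> axis_ball R r = {}"
proof (rule ccontr)
  have close: "\<bar>t - ln (cmod z)\<bar> \<le> R" if z: "z \<in> axis_ball R t" for z t
  proof -
    have "1 * cosh (t - ln (cmod z)) \<le> cmod z / Im z * cosh (t - ln (cmod z))"
      using z assms(1) cmod_div_Im_ge_1 by (intro mult_right_mono) (auto simp: mem_axis_ball)
    also have "\<dots> \<le> cosh R" using z assms(1) by (simp add: mem_axis_ball)
    finally have "cosh \<bar>t - ln (cmod z)\<bar> \<le> cosh R" by simp
    then show ?thesis using assms(1) by (subst (asm) cosh_real_nonneg_le_iff) auto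
  qed
  assume "axis_ball R p \<inter> axis_ball R r \<noteq> {}"
  then obtain z where "z \<in> axis_ball R p" "z \<in> axis_ball R r" by blast
  with close[of z p] close[of z r] assms(2) show False by linarith
qed

lemma closed_axis_ball_times:
  assumes "R \<ge> 0"
  shows "closed {t. z \<in> axis_ball R t}"
  using assms by (cases "z \<in> hplane") (auto simp: mem_axis_ball hplane_def intro!: closed_Collect_le continuous_intros)

text \<open>Only finitely many points of a locally finite set can matter for covering the axis near
\<open>t0\<close>. Moving \<open>t\<close> by at most 1 changes \<open>cosh (t - s)\<close> by a factor of at
most \<open>e\<close>, so a single ball contains all centres concerned.\<close>

lemma axis_ball_subset_hball:
  assumes "R \<ge> 0"
  shows "\<exists>\<rho>. \<forall>t. \<bar>t - t0\<bar> \<le> 1 \<longrightarrow> axis_ball R t \<subseteq> {z\<in>hplane. hdist z (axis_point t0) < \<rho>}"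
proof (intro exI allI impI subsetI)
  fix t z assume t: "\<bar>t - t0\<bar> \<le> 1" and z: "z \<in> axis_ball R t"
  \<comment> \<open>The extra 1 makes the inequality strict.\<close>
  define \<rho> where "\<rho> = arcosh (exp 1 * cosh R) + 1"
  define s where "s = ln (cmod z)"
  have zh: "z \<in> hplane" using z by (simp add: axis_ball_def)
  have ge1: "exp 1 * cosh R \<ge> 1" 
    using mult_mono[of 1 "exp 1" 1 "cosh R"] cosh_real_ge_1[of R] by simp
  have "cosh (t0 - s) \<le> exp 1 * cosh (t - s)"
  proof -
    have "exp (t0 - s) \<le> exp (1 + (t - s))" "exp (- (t0 - s)) \<le> exp (1 + - (t - s))"
      using t by auto
    then have "(exp (t0 - s) + exp (- (t0 - s))) / 2 \<le> (exp (1 + (t - s)) + exp (1 + - (t - s))) / 2"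
      by (intro divide_right_mono add_mono) auto
    also have "\<dots> = exp 1 * cosh (t - s)"
      by (simp only: exp_add cosh_field_def distrib_left times_divide_eq_right)
    finally show ?thesis by (simp add: cosh_field_def)
  qed
  then have "cmod z / Im z * cosh (t0 - s) \<le> cmod z / Im z * (exp 1 * cosh (t - s))"
    using cmod_div_Im_ge_1[OF zh] by (intro mult_left_mono) auto
  also have "\<dots> = exp 1 * (cmod z / Im z * cosh (t - s))" by simp
  also have "\<dots> \<le> exp 1 * cosh R"
    using z assms by (intro mult_left_mono) (auto simp: mem_axis_ball s_def)
  finally have "hdist z (axis_point t0) \<le> arcosh (exp 1 * cosh R)"
    using zh ge1 cosh_dist_ge_1[OF zh, of "t0 - s"] by (simp add: hdist_axis s_def arcosh_le_iff_cosh)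
  then show "z \<in> {z\<in>hplane. hdist z (axis_point t0) < arcosh (exp 1 * cosh R) + 1}"
    using zh by simp
qed

lemma axis_point_hplane: "axis_point t \<in> hplane" by (simp add: axis_point_def hplane_def)

lemma hdist_commute: "hdist z w = hdist w z"
  by (simp add: hdist_def norm_minus_commute mult.commute mult.left_commute)

text \<open>A hyperbolic circle is a Euclidean circle with a raised centre; the identity compares the two
equations and serves for the open ball as well as for its closure.\<close>

lemma hyperbolic_circle_euclidean:
  "(Re z - Re w)\<^sup>2 + (Im z * cosh R - Im w)\<^sup>2 - (Im z * sinh R)\<^sup>2 =
   (cmod (z - w))\<^sup>2 - 2 * Im z * Im w * (cosh R - 1)"
  unfolding cmod_power2 power_mult_distrib sinh_square_eq
  by (simp add: algebra_simps power2_eq_square)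

lemma hball_eq_ball:
  assumes "z \<in> hplane" "R > 0"
  shows "hball z R = ball (Complex (Re z) (Im z * cosh R)) (Im z * sinh R)"
proof (rule set_eqI)
  fix w
  have y: "Im z > 0" using assms by (simp add: hplane_def)
  have iff: "(cmod (z - w))\<^sup>2 < 2 * Im z * Im w * (cosh R - 1) \<longleftrightarrow>
        (Re z - Re w)\<^sup>2 + (Im z * cosh R - Im w)\<^sup>2 < (Im z * sinh R)\<^sup>2"
    using hyperbolic_circle_euclidean[of z w R] by linarith
  have "w \<in> ball (Complex (Re z) (Im z * cosh R)) (Im z * sinh R) \<longleftrightarrow> 
     (Re z - Re w)\<^sup>2 + (Im z * cosh R - Im w)\<^sup>2 < (Im z * sinh R)\<^sup>2"
    using y assms(2) by (simp add: dist_norm cmod_def real_less_lsqrt real_sqrt_less_iff)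
      (metis abs_of_nonneg mult_nonneg_nonneg less_imp_le real_sqrt_abs real_sqrt_less_iff sinh_real_nonneg_iff)
  moreover have "w \<in> hplane" if *: "(cmod (z - w))\<^sup>2 < 2 * Im z * Im w * (cosh R - 1)"
  proof -
    have "0 < 2 * Im z * Im w * (cosh R - 1)" using * zero_le_power2 le_less_trans by blast
    moreover have "cosh R \<ge> 1" by (rule cosh_real_ge_1)
    ultimately show ?thesis using y by (auto simp: hplane_def zero_less_mult_iff)
  qed
  moreover have "hdist z w < R \<longleftrightarrow> (cmod (z - w))\<^sup>2 < 2 * Im z * Im w * (cosh R - 1)" if "w \<in> hplane"
  proof -
    have w: "Im w > 0" using that by (simp add: hplane_def)
    then show ?thesis
      using y assms(2) by (simp add: hdist_def arcosh_le_iff_cosh field_simps)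
  qed
  ultimately show "w \<in> hball z R \<longleftrightarrow> w \<in> ball (Complex (Re z) (Im z * cosh R)) (Im z * sinh R)"
    using iff by (auto simp: hball_def)
qed

lemma axis_in_closure_hball:
  assumes "z \<in> hplane" "R > 0"
  shows "axis_point t \<in> closure (hball z R) \<longleftrightarrow> z \<in> axis_ball R t"
proof -
  define w where "w = axis_point t"
  have y: "Im z > 0" and w: "Im w > 0" using assms by (simp_all add: hplane_def w_def axis_point_def)
  have "w \<in> closure (hball z R) \<longleftrightarrow> (Re z - Re w)\<^sup>2 + (Im z * cosh R - Im w)\<^sup>2 \<le> (Im z * sinh R)\<^sup>2"
    using y assms by (simp add: hball_eq_ball dist_norm cmod_def)
      (metis abs_of_nonneg mult_nonneg_nonneg less_imp_le real_sqrt_abs real_sqrt_le_iff sinh_real_nonneg_iff)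
  also have "\<dots> \<longleftrightarrow> (cmod (z - w))\<^sup>2 \<le> 2 * Im z * Im w * (cosh R - 1)"
    using hyperbolic_circle_euclidean[of z w R] by linarith
  also have "\<dots> \<longleftrightarrow> hdist z w \<le> R"
    using y w assms(2) by (simp add: hdist_def arcosh_le_iff_cosh field_simps)
  finally show ?thesis using assms by (simp add: axis_ball_def w_def)
qed

lemma geodesic_segment_axis: "geodesic_segment r (axis_point ` {0..r})"
proof -
  have "hdist (axis_point s) (axis_point t) = \<bar>s - t\<bar>" for s t
  proof -
    have "hdist (axis_point s) (axis_point t) = arcosh (cosh \<bar>t - s\<bar>)"
      using hdist_axis[OF axis_point_hplane, of s t] by (simp add: axis_point_def cmod_def)
    also have "\<dots> = \<bar>s - t\<bar>" by (subst arcosh_cosh_real) auto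
    finally show ?thesis .
  qed
  then show ?thesis
    unfolding geodesic_segment_def using axis_point_hplane by (intro exI[of _ axis_point]) auto
qed

section \<open>Hyperbolic area in Fermi coordinates\<close>

text \<open>The area, per unit of length along the axis, of the centres whose ball meets the axis in an interval
longer than \<open>v\<close>. Such centres lie within distance \<open>arcosh (cosh R / cosh (v/2))\<close> of
the axis.\<close>

definition reach_rate :: "real \<Rightarrow> real \<Rightarrow> real" where
  "reach_rate R v = 2 * sinh (arcosh (cosh R / cosh (v / 2)))"

definition reach_area :: "real \<Rightarrow> real \<Rightarrow> real" where
  "reach_area R \<tau> = integral {0..min \<tau> (2 * R)} (reach_rate R)"

lemma cosh_quotient_ge_1: "\<bar>s\<bar> \<le> R \<Longrightarrow> cosh R / cosh s \<ge> (1::real)"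
  using cosh_real_nonneg_le_iff[of "\<bar>s\<bar>" R] by (simp add: divide_simps)

lemma reach_rate_nonneg: "v \<in> {0..2*R} \<Longrightarrow> reach_rate R v \<ge> 0"
  using cosh_quotient_ge_1[of "v/2" R] by (simp add: reach_rate_def)

lemma continuous_on_reach_rate: "continuous_on {0..2*R} (reach_rate R)"
  unfolding reach_rate_def using cosh_quotient_ge_1[of "_/2" R]
  by (intro continuous_intros) auto

lemma reach_area_has_integral: "(reach_rate R has_integral reach_area R \<tau>) {0..min \<tau> (2 * R)}"
  unfolding reach_area_def
  by (intro integrable_integral integrable_continuous_real continuous_on_subset[OF continuous_on_reach_rate]) auto

lemma reach_area_nonneg: "reach_area R \<tau> \<ge> 0"
  by (rule has_integral_nonneg[OF reach_area_has_integral]) (auto intro: reach_rate_nonneg)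

lemma measurable_Complex [measurable]:
  "(\<lambda>p. Complex (fst p) (snd p)) \<in> borel_measurable borel"
  unfolding Complex_eq by (intro borel_measurable_continuous_onI continuous_intros)

lemma measurable_Complex' [measurable (raw)]:
  assumes [measurable]: "f \<in> borel_measurable N" "g \<in> borel_measurable N"
  shows "(\<lambda>x. Complex (f x) (g x)) \<in> borel_measurable N"
  unfolding Complex_eq by measurable

lemma lborel_complex: "lborel = distr (lborel \<Otimes>\<^sub>M lborel) borel (\<lambda>p. Complex (fst p) (snd p))"
proof (rule lborel_eqI)
  fix a b :: complex
  assume "\<And>c. c \<in> Basis \<Longrightarrow> a \<bullet> c \<le> b \<bullet> c"
  from this[of 1] this[of \<i>] have le: "Re a \<le> Re b" "Im a \<le> Im b" by (auto simp: Basis_complex_def)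
  have "(\<lambda>p. Complex (fst p) (snd p)) -` box a b = box (Re a) (Re b) \<times> box (Im a) (Im b)"
    by (auto simp: box_def Basis_complex_def)
  then have "emeasure (distr (lborel \<Otimes>\<^sub>M lborel) borel (\<lambda>p. Complex (fst p) (snd p))) (box a b) =
      emeasure (lborel \<Otimes>\<^sub>M lborel) ({Re a<..<Re b} \<times> {Im a<..<Im b})"
    by (subst emeasure_distr) (auto simp: space_pair_measure)
  also have "\<dots> = ennreal (Re b - Re a) * ennreal (Im b - Im a)"
    using le by (subst lborel.emeasure_pair_measure_Times) auto
  also have "\<dots> = (\<Prod>c\<in>Basis. (b - a) \<bullet> c)"
    using le by (simp add: Basis_complex_def ennreal_mult)
  finally show "emeasure (distr (lborel \<Otimes>\<^sub>M lborel) borel (\<lambda>p. Complex (fst p) (snd p))) (box a b) =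
    (\<Prod>c\<in>Basis. (b - a) \<bullet> c)" .
qed simp

lemma nn_integral_lborel_complex:
  assumes [measurable]: "f \<in> borel_measurable borel"
  shows "(\<integral>\<^sup>+z. f z \<partial>lborel) = (\<integral>\<^sup>+y. \<integral>\<^sup>+x. f (Complex x y) \<partial>lborel \<partial>lborel)"
proof -
  have "(\<integral>\<^sup>+z. f z \<partial>lborel) = (\<integral>\<^sup>+p. f (Complex (fst p) (snd p)) \<partial>(lborel \<Otimes>\<^sub>M lborel))"
    by (subst lborel_complex, subst nn_integral_distr) auto
  also have "\<dots> = (\<integral>\<^sup>+y. \<integral>\<^sup>+x. f (Complex x y) \<partial>lborel \<partial>lborel)"
    by (subst lborel_pair.nn_integral_snd[symmetric]) auto
  finally show ?thesis .
qed

lemma hplane_borel [measurable]: "hplane \<in> sets borel"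
  unfolding hplane_def by measurable

lemma sets_harea_iff: "A \<in> sets harea \<longleftrightarrow> A \<in> sets borel \<and> A \<subseteq> hplane"
  unfolding harea_def by (auto simp: sets_restrict_space_iff)

lemma emeasure_harea:
  assumes "A \<in> sets borel" "A \<subseteq> hplane"
  shows "emeasure harea A = (\<integral>\<^sup>+y. \<integral>\<^sup>+x. ennreal (1 / y\<^sup>2) * indicator A (Complex x y) \<partial>lborel \<partial>lborel)"
proof -
  have [measurable]: "A \<in> sets borel" by fact
  have "emeasure harea A = (\<integral>\<^sup>+z. ennreal (1 / (Im z)\<^sup>2) * indicator A z \<partial>restrict_space lborel hplane)"
    unfolding harea_def using assms
    by (intro emeasure_density measurable_restrict_space1) (auto simp: sets_restrict_space_iff)
  also have "\<dots> = (\<integral>\<^sup>+z. ennreal (1 / (Im z)\<^sup>2) * indicator A z * indicator hplane z \<partial>lborel)"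
    by (rule nn_integral_restrict_space) simp
  also have "\<dots> = (\<integral>\<^sup>+z. ennreal (1 / (Im z)\<^sup>2) * indicator A z \<partial>lborel)"
    using assms by (intro nn_integral_cong) (auto simp: indicator_def)
  also have "\<dots> = (\<integral>\<^sup>+y. \<integral>\<^sup>+x. ennreal (1 / y\<^sup>2) * indicator A (Complex x y) \<partial>lborel \<partial>lborel)"
    by (subst nn_integral_lborel_complex) auto
  finally show ?thesis .
qed

lemma axis_ball_borel: "R \<ge> 0 \<Longrightarrow> axis_ball R t \<in> sets borel"
proof -
  assume "R \<ge> 0"
  then have "axis_ball R t = {z. Im z > 0 \<and> cmod z / Im z * cosh (t - ln (cmod z)) \<le> cosh R}"
    by (auto simp: mem_axis_ball hplane_def)
  also have "\<dots> \<in> sets borel"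
    by (simp add: cosh_field_def)
  finally show ?thesis .
qed

lemma axis_ball_sets_harea: "R \<ge> 0 \<Longrightarrow> axis_ball R t \<in> sets harea"
  by (simp add: sets_harea_iff axis_ball_borel) (auto simp: axis_ball_def)

text \<open>The point at signed distance \<open>\<rho>\<close> from the axis whose foot is the point of the axis
at \<open>s\<close>.\<close>

definition fermi :: "real \<Rightarrow> real \<Rightarrow> complex" where
  "fermi \<rho> s = Complex (exp s * tanh \<rho>) (exp s / cosh \<rho>)"

text \<open>The area element is \<open>cosh \<rho> d\<rho> ds\<close>. Substituting \<open>x = y sinh
\<rho>\<close> for fixed \<open>y\<close>, exchanging the integrals and then substituting \<open>y = e\<^sup>s /
cosh \<rho>\<close> for fixed \<open>\<rho>\<close> reduces this to one-dimensional changes of variables on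
bounded intervals.\<close>

lemma emeasure_harea_fermi:
  assumes A: "A \<in> sets borel" "A \<subseteq> hplane"
    and bounded: "\<And>z. z \<in> A \<Longrightarrow> cmod z \<le> Im z * cosh R \<and> ln (cmod z) \<in> {a..b}"
    and "R > 0" "a < b"
  shows "emeasure harea A =
    (\<integral>\<^sup>+\<rho>. ennreal (cosh \<rho>) * indicator {-R..R} \<rho> *
       (\<integral>\<^sup>+s. indicator A (fermi \<rho> s) * indicator {a..b} s \<partial>lborel) \<partial>lborel)"
proof -
  note [measurable] = A(1)
  define J where "J y \<rho> = ennreal (cosh \<rho>) * indicator {-R..R} \<rho> *
     (ennreal (1 / y) * indicator A (Complex (y * sinh \<rho>) y))" for y \<rho>
  have inner_x: "(\<integral>\<^sup>+x. ennreal (1 / y\<^sup>2) * indicator A (Complex x y) \<partial>lborel) = (\<integral>\<^sup>+\<rho>. J y \<rho> \<partial>lborel)" for y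
  proof (cases "y > 0")
    case True
    have "\<bar>x\<bar> \<le> y * sinh R" if "Complex x y \<in> A" for x
    proof -
      have "x\<^sup>2 + y\<^sup>2 \<le> (y * cosh R)\<^sup>2"
        using bounded[OF that] power_mono[of "cmod (Complex x y)" "y * cosh R" 2]
        by (simp add: cmod_power2)
      then have "x\<^sup>2 \<le> (y * sinh R)\<^sup>2" by (simp add: sinh_square_eq power_mult_distrib algebra_simps)
      then show ?thesis using True \<open>R > 0\<close> abs_le_square_iff[of x "y * sinh R"] by simp
    qed
    then have "(\<integral>\<^sup>+x. ennreal (1 / y\<^sup>2) * indicator A (Complex x y) \<partial>lborel) =
      (\<integral>\<^sup>+x. ennreal (1 / y\<^sup>2) * indicator A (Complex x y) * indicator {y * sinh (-R)..y * sinh R} x \<partial>lborel)"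
      by (intro nn_integral_cong) (force simp: indicator_def abs_le_iff)
    also have "\<dots> = (\<integral>\<^sup>+\<rho>. ennreal (1 / y\<^sup>2) * indicator A (Complex (y * sinh \<rho>) y) *
        ennreal (y * cosh \<rho>) * indicator {-R..R} \<rho> \<partial>lborel)"
      using True \<open>R > 0\<close>
      by (intro nn_integral_substitution_aux) (auto intro!: derivative_eq_intros continuous_intros)
    also have "\<dots> = (\<integral>\<^sup>+\<rho>. J y \<rho> \<partial>lborel)"
    proof (intro nn_integral_cong)
      fix \<rho> :: real
      have "ennreal (1 / y\<^sup>2) * ennreal (y * cosh \<rho>) = ennreal (cosh \<rho>) * ennreal (1 / y)"
        using True by (simp add: ennreal_mult[symmetric] power2_eq_square del: ennreal_mult'')
      then show "ennreal (1 / y\<^sup>2) * indicator A (Complex (y * sinh \<rho>) y) *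
        ennreal (y * cosh \<rho>) * indicator {-R..R} \<rho> = J y \<rho>"
        by (simp add: J_def indicator_def)
    qed
    finally show ?thesis .
  next
    case False
    then have "indicator A (Complex x y) = (0::ennreal)" for x
      using A(2) by (auto simp: hplane_def indicator_def)
    then show ?thesis by (simp add: J_def)
  qed
  have inner_y: "(\<integral>\<^sup>+y. J y \<rho> \<partial>lborel) = ennreal (cosh \<rho>) * indicator {-R..R} \<rho> *
     (\<integral>\<^sup>+s. indicator A (fermi \<rho> s) * indicator {a..b} s \<partial>lborel)" for \<rho>
  proof -
    have "exp a \<le> y * cosh \<rho>" "y * cosh \<rho> \<le> exp b" "y > 0" if z: "Complex (y * sinh \<rho>) y \<in> A" for y
    proof -
      show y: "y > 0" using z A(2) by (auto simp: hplane_def)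
      have "cmod (Complex (y * sinh \<rho>) y) = sqrt ((y * cosh \<rho>)\<^sup>2)"
        by (simp add: cmod_def cosh_square_eq power_mult_distrib algebra_simps)
      then have "cmod (Complex (y * sinh \<rho>) y) = y * cosh \<rho>" using y by simp
      then have "a \<le> ln (y * cosh \<rho>)" "ln (y * cosh \<rho>) \<le> b" using bounded[OF z] by auto
      then show "exp a \<le> y * cosh \<rho>" "y * cosh \<rho> \<le> exp b" 
        using y by (simp_all add: ln_ge_iff) (simp add: ln_le_cancel_iff[symmetric, of _ "exp b"] del: ln_le_cancel_iff)
    qed
    then have "(\<integral>\<^sup>+y. ennreal (1 / y) * indicator A (Complex (y * sinh \<rho>) y) \<partial>lborel) =
      (\<integral>\<^sup>+y. ennreal (1 / y) * indicator A (Complex (y * sinh \<rho>) y) * indicator {exp a / cosh \<rho>..exp b / cosh \<rho>} y \<partial>lborel)"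
      by (intro nn_integral_cong) (force simp: indicator_def field_simps)
    also have "\<dots> = (\<integral>\<^sup>+s. ennreal (1 / (exp s / cosh \<rho>)) * indicator A (Complex (exp s / cosh \<rho> * sinh \<rho>) (exp s / cosh \<rho>)) *
        ennreal (exp s / cosh \<rho>) * indicator {a..b} s \<partial>lborel)"
      using \<open>a < b\<close>
      by (intro nn_integral_substitution_aux) (auto intro!: derivative_eq_intros continuous_intros)
    also have "\<dots> = (\<integral>\<^sup>+s. indicator A (fermi \<rho> s) * indicator {a..b} s \<partial>lborel)"
    proof (intro nn_integral_cong)
      fix s :: real
      have "ennreal (1 / (exp s / cosh \<rho>)) * ennreal (exp s / cosh \<rho>) = 1"
        by (subst ennreal_mult[symmetric]) auto
      then show "ennreal (1 / (exp s / cosh \<rho>)) * indicator A (Complex (exp s / cosh \<rho> * sinh \<rho>) (exp s / cosh \<rho>)) *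
        ennreal (exp s / cosh \<rho>) * indicator {a..b} s = indicator A (fermi \<rho> s) * indicator {a..b} s"
        by (simp add: fermi_def tanh_def indicator_def)
    qed
    finally show ?thesis
      unfolding J_def by (subst nn_integral_cmult) auto
  qed
  have "emeasure harea A = (\<integral>\<^sup>+y. \<integral>\<^sup>+\<rho>. J y \<rho> \<partial>lborel \<partial>lborel)"
    by (simp add: emeasure_harea[OF A] inner_x)
  also have "\<dots> = (\<integral>\<^sup>+\<rho>. \<integral>\<^sup>+y. J y \<rho> \<partial>lborel \<partial>lborel)"
    by (rule lborel_pair.Fubini') (simp add: J_def sinh_field_def cosh_field_def)
  finally show ?thesis by (simp add: inner_y)
qed

lemma fermi_hplane: "fermi \<rho> s \<in> hplane"
  by (simp add: fermi_def hplane_def)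

lemma cmod_fermi: "cmod (fermi \<rho> s) = exp s"
proof -
  have "(tanh \<rho>)\<^sup>2 + (1 / cosh \<rho>)\<^sup>2 = 1"
    by (simp add: tanh_def power_divide sinh_square_eq divide_simps)
  then have "(exp s * tanh \<rho>)\<^sup>2 + (exp s / cosh \<rho>)\<^sup>2 = (exp s)\<^sup>2"
    by (simp add: power_mult_distrib power_divide flip: distrib_left) (metis distrib_left mult.right_neutral times_divide_eq_right)
  then show ?thesis by (simp add: fermi_def cmod_def)
qed

text \<open>Since the right-hand side is symmetric in \<open>v\<close> and \<open>\<rho>\<close>, the
half-length of the interval cut out by a ball at distance \<open>\<rho>\<close>, and the largest distance at
which a given half-length is reached, are the same function.\<close>

lemma le_half_length_iff:
  fixes \<rho> v :: real
  assumes "\<rho> \<in> {-R..R}"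
  shows "\<bar>v\<bar> \<le> arcosh (cosh R / cosh \<rho>) \<longleftrightarrow> cosh \<rho> * cosh v \<le> cosh R"
proof -
  have q: "cosh R / cosh \<rho> \<ge> 1"
    using assms by (intro cosh_quotient_ge_1) auto
  have "\<bar>v\<bar> \<le> arcosh (cosh R / cosh \<rho>) \<longleftrightarrow> cosh \<bar>v\<bar> \<le> cosh (arcosh (cosh R / cosh \<rho>))"
    using q by (subst cosh_real_nonneg_le_iff) auto
  also have "\<dots> \<longleftrightarrow> cosh \<rho> * cosh v \<le> cosh R"
    using q by (simp add: field_simps)
  finally show ?thesis .
qed

lemma fermi_in_axis_ball:
  assumes "R > 0" "\<rho> \<in> {-R..R}"
  shows "fermi \<rho> s \<in> axis_ball R t \<longleftrightarrow> \<bar>t - s\<bar> \<le> arcosh (cosh R / cosh \<rho>)"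
proof -
  have "fermi \<rho> s \<in> axis_ball R t \<longleftrightarrow> cosh \<rho> * cosh (t - s) \<le> cosh R"
    using assms by (simp add: mem_axis_ball fermi_hplane cmod_fermi) (simp add: fermi_def mult.commute)
  then show ?thesis using le_half_length_iff[OF assms(2)] by simp
qed

lemma half_length_le:
  fixes v :: real
  assumes "R > 0" "v \<in> {-R..R}"
  shows "arcosh (cosh R / cosh v) \<in> {0..R}"
proof -
  have "cosh R / cosh v \<le> cosh R" using cosh_real_ge_1[of v] by (simp add: divide_simps)
  then show ?thesis
    using cosh_quotient_ge_1[of v R] assms by (simp add: arcosh_le_iff_cosh abs_le_iff)
qed

text \<open>At distance \<open>\<rho>\<close> from the axis, with half-length \<open>w(\<rho>)\<close>, the feet
of admissible centres form an interval of length \<open>min (r - p) (2 w(\<rho>))\<close>. Writing this as an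
integral over the \<open>v \<in> [0, r - p]\<close> with \<open>v \<le> 2 w(\<rho>)\<close> and integrating over
\<open>\<rho>\<close> first gives the reach rate.\<close>

lemma emeasure_axis_ball_diff:
  assumes "R > 0" "p \<le> r"
  shows "emeasure harea (axis_ball R r - axis_ball R p) = ennreal (reach_area R (r - p))"
proof -
  define A where "A = axis_ball R r - axis_ball R p"
  define w where "w \<rho> = arcosh (cosh R / cosh \<rho>)" for \<rho>
  define T where "T = min (r - p) (2 * R)"
  define L where "L v \<rho> = ennreal (cosh \<rho>) *
    (indicator {0..T} v * indicator {..cosh R} (cosh \<rho> * cosh (v / 2)))" for v \<rho>
  have A: "A \<in> sets borel" "A \<subseteq> hplane"
    using assms by (auto simp: A_def axis_ball_borel) (auto simp: axis_ball_def)
  have bounded: "cmod z \<le> Im z * cosh R \<and> ln (cmod z) \<in> {r - R..r + R}" if "z \<in> A" for z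
  proof -
    define s where "s = ln (cmod z)"
    have z: "z \<in> hplane" "cmod z / Im z * cosh (r - s) \<le> cosh R" 
      using that assms by (auto simp: A_def mem_axis_ball s_def)
    have q: "cmod z / Im z \<ge> 1" by (rule cmod_div_Im_ge_1[OF z(1)])
    have "cosh \<bar>r - s\<bar> \<le> cosh R"
      using mult_right_mono[OF q, of "cosh (r - s)"] z(2) by simp
    then have "\<bar>r - s\<bar> \<le> R" using assms by (subst (asm) cosh_real_nonneg_le_iff) auto
    moreover have "cmod z / Im z \<le> cosh R"
      using mult_left_mono[OF cosh_real_ge_1[of "r - s"], of "cmod z / Im z"] q z(2) by simp
    then have "cmod z \<le> Im z * cosh R" using z(1) by (simp add: hplane_def field_simps)
    ultimately show ?thesis by (auto simp: s_def abs_le_iff)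
  qed
  have slice: "(\<integral>\<^sup>+s. indicator A (fermi \<rho> s) * indicator {r - R..r + R} s \<partial>lborel) =
      (\<integral>\<^sup>+v. indicator {0..T} v * indicator {..2 * w \<rho>} v \<partial>lborel)" if \<rho>: "\<rho> \<in> {-R..R}" for \<rho>
  proof -
    have w: "0 \<le> w \<rho>" "w \<rho> \<le> R" using half_length_le[OF assms(1) \<rho>] by (auto simp: w_def)
    have "(\<integral>\<^sup>+s. indicator A (fermi \<rho> s) * indicator {r - R..r + R} s \<partial>lborel) =
      (\<integral>\<^sup>+s. indicator (if p + w \<rho> < r - w \<rho> then {r - w \<rho>..r + w \<rho>} else {p + w \<rho><..r + w \<rho>}) s \<partial>lborel)"
      using w assms fermi_in_axis_ball[OF assms(1) \<rho>]
      by (intro nn_integral_cong) (auto simp: indicator_def A_def w_def[symmetric] abs_le_iff)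
    also have "\<dots> = ennreal (min (r - p) (2 * w \<rho>))"
      using w assms by (subst nn_integral_indicator) (auto simp: min_def)
    also have "\<dots> = (\<integral>\<^sup>+v. indicator {0..min (r - p) (2 * w \<rho>)} v \<partial>lborel)"
      using w assms by (subst nn_integral_indicator) auto
    also have "\<dots> = (\<integral>\<^sup>+v. indicator {0..T} v * indicator {..2 * w \<rho>} v \<partial>lborel)"
      using w by (intro nn_integral_cong) (auto simp: indicator_def T_def)
    finally show ?thesis .
  qed
  have "emeasure harea A = (\<integral>\<^sup>+\<rho>. ennreal (cosh \<rho>) * indicator {-R..R} \<rho> *
       (\<integral>\<^sup>+s. indicator A (fermi \<rho> s) * indicator {r - R..r + R} s \<partial>lborel) \<partial>lborel)"
    using A bounded assms by (intro emeasure_harea_fermi) auto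
  also have "\<dots> = (\<integral>\<^sup>+\<rho>. \<integral>\<^sup>+v. L v \<rho> \<partial>lborel \<partial>lborel)"
  proof (intro nn_integral_cong)
    fix \<rho> :: real
    show "ennreal (cosh \<rho>) * indicator {-R..R} \<rho> *
       (\<integral>\<^sup>+s. indicator A (fermi \<rho> s) * indicator {r - R..r + R} s \<partial>lborel) = (\<integral>\<^sup>+v. L v \<rho> \<partial>lborel)"
    proof (cases "\<rho> \<in> {-R..R}")
      case True
      have "ennreal (cosh \<rho>) * (\<integral>\<^sup>+v. indicator {0..T} v * indicator {..2 * w \<rho>} v \<partial>lborel) =
         (\<integral>\<^sup>+v. ennreal (cosh \<rho>) * (indicator {0..T} v * indicator {..2 * w \<rho>} v) \<partial>lborel)"
        by (rule nn_integral_cmult[symmetric]) auto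
      also have "\<dots> = (\<integral>\<^sup>+v. L v \<rho> \<partial>lborel)"
      proof (intro nn_integral_cong)
        fix v :: real
        have "v \<le> 2 * w \<rho> \<longleftrightarrow> cosh \<rho> * cosh (v / 2) \<le> cosh R" if "v \<ge> 0"
          using le_half_length_iff[OF True, of "v / 2"] that by (simp add: w_def mult.commute)
        then show "ennreal (cosh \<rho>) * (indicator {0..T} v * indicator {..2 * w \<rho>} v) = L v \<rho>"
          by (auto simp: indicator_def L_def)
      qed
      finally show ?thesis using True by (simp add: slice)
    next
      case False
      \<comment> \<open>Outside the strip \<open>|\<rho>| \<le> R\<close> the condition defining
      \<open>L\<close> fails by itself.\<close>
      have "cosh R < cosh \<bar>\<rho>\<bar>"
        using False assms by (subst cosh_real_nonneg_less_iff) auto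
      also have "\<dots> \<le> cosh \<rho> * cosh (v / 2)" for v
        using mult_left_mono[OF cosh_real_ge_1[of "v/2"], of "cosh \<rho>"] by simp
      finally have "L v \<rho> = 0" for v
        by (simp add: L_def indicator_def not_le)
      then show ?thesis using False by simp
    qed
  qed
  also have "\<dots> = (\<integral>\<^sup>+v. \<integral>\<^sup>+\<rho>. L v \<rho> \<partial>lborel \<partial>lborel)"
    by (rule lborel_pair.Fubini') (simp add: L_def cosh_field_def)
  also have "\<dots> = (\<integral>\<^sup>+v. ennreal (reach_rate R v) * indicator {0..T} v \<partial>lborel)"
  proof (intro nn_integral_cong)
    fix v :: real
    show "(\<integral>\<^sup>+\<rho>. L v \<rho> \<partial>lborel) = ennreal (reach_rate R v) * indicator {0..T} v"
    proof (cases "v \<in> {0..T}")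
      case True
      then have w: "0 \<le> w (v/2)" using half_length_le[OF assms(1), of "v/2"] by (auto simp: w_def T_def)
      have "(\<integral>\<^sup>+\<rho>. L v \<rho> \<partial>lborel) = (\<integral>\<^sup>+\<rho>. ennreal (cosh \<rho>) * indicator {-w (v/2)..w (v/2)} \<rho> \<partial>lborel)"
      proof (intro nn_integral_cong)
        fix \<rho> :: real
        have "\<rho> \<in> {-w (v/2)..w (v/2)} \<longleftrightarrow> cosh \<rho> * cosh (v / 2) \<le> cosh R"
          using le_half_length_iff[of "v/2" R \<rho>] True by (auto simp: w_def T_def mult.commute)
        then show "L v \<rho> = ennreal (cosh \<rho>) * indicator {-w (v/2)..w (v/2)} \<rho>"
          using True by (auto simp: indicator_def L_def)
      qed
      also have "\<dots> = ennreal (sinh (w (v/2)) - sinh (- w (v/2)))"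
        using w by (intro nn_integral_FTC_Icc) (auto intro!: derivative_eq_intros simp: cosh_field_def)
      finally show ?thesis using True by (simp add: reach_rate_def w_def)
    next
      case False
      then show ?thesis by (simp add: L_def)
    qed
  qed
  also have "\<dots> = ennreal (reach_area R (r - p))"
    using reach_area_has_integral[of R "r - p"] reach_rate_nonneg[of _ R]
    unfolding T_def by (intro nn_integral_has_integral_lebesgue') auto
  finally show ?thesis by (simp add: A_def)
qed

section \<open>The renewal inequalities for covering a segment\<close>

locale axis_cover =
  fixes M :: "'w measure" and X :: "'w \<Rightarrow> complex set" and l R :: real
  assumes l_pos: "l > 0" and R_pos: "R > 0" and poisson: "poisson_process M X l"
begin

sublocale prob_space M
  using poisson by (simp add: poisson_process_def)

definition void :: "complex set \<Rightarrow> 'w set" where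
  "void A = {\<omega> \<in> space M. X \<omega> \<inter> A = {}}"

text \<open>For such sets, counting 0 points means containing no point; an infinite set would also have
cardinality 0.\<close>

definition observable :: "complex set set" where
  "observable = {A \<in> sets harea. emeasure harea A < \<infinity> \<and> (\<forall>\<omega>\<in>space M. finite (X \<omega> \<inter> A))}"

text \<open>The events decided by the points inside \<open>U\<close>. They are generated by void events, because
void probabilities alone give independence.\<close>

definition events_in :: "complex set \<Rightarrow> 'w set set" where
  "events_in U = sigma_sets (space M) (void ` {A \<in> observable. A \<subseteq> U})"

lemma observable_Un: "A \<in> observable \<Longrightarrow> B \<in> observable \<Longrightarrow> A \<union> B \<in> observable"
  unfolding observable_def
  by (auto simp: Int_Un_distrib intro!: order.strict_trans1[OF emeasure_subadditive])

lemma observable_Diff: "A \<in> observable \<Longrightarrow> B \<in> sets harea \<Longrightarrow> A - B \<in> observable"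
  unfolding observable_def
  by (auto intro: finite_subset[rotated] le_less_trans[OF emeasure_mono[of "A - B" A]])

lemma void_Int: "void A \<inter> void B = void (A \<union> B)"
  by (auto simp: void_def)

lemma
  assumes "A \<in> observable"
  shows void_event: "void A \<in> events"
    and prob_void: "prob (void A) = exp (- (l * measure harea A))"
proof -
  have A: "A \<in> sets harea" "emeasure harea A < \<infinity>" "\<And>\<omega>. \<omega> \<in> space M \<Longrightarrow> finite (X \<omega> \<inter> A)"
    using assms by (auto simp: observable_def)
  have count: "(\<lambda>\<omega>. card (X \<omega> \<inter> A)) \<in> measurable M (count_space UNIV)"
    and law: "\<And>n. measure M {\<omega> \<in> space M. card (X \<omega> \<inter> A) = n} =
             (l * measure harea A) ^ n / fact n * exp (- (l * measure harea A))"
    using poisson A(1,2) unfolding poisson_process_def by blast+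
  have void: "void A = {\<omega> \<in> space M. card (X \<omega> \<inter> A) = 0}"
    using A(3) by (auto simp: void_def)
  have "void A = (\<lambda>\<omega>. card (X \<omega> \<inter> A)) -` {0} \<inter> space M"
    using void by auto
  also have "\<dots> \<in> events"
    by (rule measurable_sets[OF count]) simp
  finally show "void A \<in> events" .
  show "prob (void A) = exp (- (l * measure harea A))"
    unfolding void law by simp
qed

lemma events_in_events: "events_in U \<subseteq> events"
  unfolding events_in_def by (rule sets.sigma_sets_subset) (auto intro: void_event)

text \<open>Void events form a family closed under intersection, with \<open>void A \<inter> void B = void (A
\<union> B)\<close>. For disjoint sets, void probabilities multiply because area is additive.\<close>

lemma indep_disjoint_regions:
  assumes "U \<inter> W = {}"
  shows "indep_set (events_in U) (events_in W)"
  unfolding events_in_def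
proof (rule indep_set_sigma_sets)
  have "prob (void A \<inter> void B) = prob (void A) * prob (void B)"
    if "A \<in> observable" "A \<subseteq> U" "B \<in> observable" "B \<subseteq> W" for A B
  proof -
    have "measure harea (A \<union> B) = measure harea A + measure harea B"
      using that assms by (intro measure_Union) (auto simp: observable_def)
    then show ?thesis
      using that by (simp add: void_Int prob_void observable_Un exp_add[symmetric] algebra_simps)
  qed
  then show "indep_set (void ` {A \<in> observable. A \<subseteq> U}) (void ` {A \<in> observable. A \<subseteq> W})"
    by (intro indep_setI) (auto intro: void_event)
  show "Int_stable (void ` {A \<in> observable. A \<subseteq> U})" for U
    by (auto intro!: Int_stableI simp: void_Int observable_Un)
  then show "Int_stable (void ` {A \<in> observable. A \<subseteq> W})" .
qed

lemma prob_Int_disjoint_regions: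
  assumes "E \<in> events_in U" "F \<in> events_in W" "U \<inter> W = {}"
  shows "prob (E \<inter> F) = prob E * prob F"
  by (rule indep_setD[OF indep_disjoint_regions[OF assms(3)] assms(1,2)])

lemma void_in: "A \<in> observable \<Longrightarrow> A \<subseteq> U \<Longrightarrow> void A \<in> events_in U"
  unfolding events_in_def by (rule sigma_sets.Basic) auto

lemma sigma_algebra_events_in: "sigma_algebra (space M) (events_in U)"
  unfolding events_in_def by (rule sigma_algebra_sigma_sets) (auto simp: void_def)

lemma axis_ball_observable: "axis_ball R t \<in> observable"
proof -
  \<comment> \<open>Any distance beyond \<open>2 R\<close> would do.\<close>
  have "axis_ball R t = axis_ball R t - axis_ball R (t - 3 * R)"
    using axis_ball_far[of R t "t - 3 * R"] R_pos by auto
  then have "emeasure harea (axis_ball R t) < \<infinity>"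
    using emeasure_axis_ball_diff[of R "t - 3 * R" t] R_pos by simp
  moreover have "finite (X \<omega> \<inter> axis_ball R t)" if "\<omega> \<in> space M" for \<omega>
  proof (rule finite_subset)
    show "X \<omega> \<inter> axis_ball R t \<subseteq> X \<omega> \<inter> hball (axis_point t) (R + 1)"
      by (auto simp: axis_ball_def hball_def hdist_commute)
    show "finite (X \<omega> \<inter> hball (axis_point t) (R + 1))"
      using poisson that axis_point_hplane by (simp add: poisson_process_def)
  qed
  ultimately show ?thesis
    using axis_ball_sets_harea R_pos by (simp add: observable_def)
qed

text \<open>Discarding the centres in \<open>Q\<close> turns covering into an event independent of what happens
in \<open>Q\<close>, as the lower bound requires. For negative \<open>s\<close> it is the sure event, which is
the initial condition of the renewal inequalities.\<close>

definition covered :: "complex set \<Rightarrow> real \<Rightarrow> 'w set" where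
  "covered Q s = {\<omega> \<in> space M. \<forall>t\<in>{0..s}. X \<omega> \<inter> (axis_ball R t - Q) \<noteq> {}}"

text \<open>Finitely many closed intervals are relevant near a given point of the axis, so the uncovered set is
relatively open and, unless empty, meets a countable dense subset of \<open>[0, s]\<close>. Covering is thus a
countable intersection of complements of void events.\<close>

lemma covered_in:
  assumes Q: "Q \<in> sets harea" and W: "\<And>t. t \<in> {0..s} \<Longrightarrow> axis_ball R t - Q \<subseteq> W"
  shows "covered Q s \<in> events_in W"
proof -
  interpret W: sigma_algebra "space M" "events_in W" by (rule sigma_algebra_events_in)
  obtain T where T: "countable T" "T \<subseteq> {0..s}" "{0..s} \<subseteq> closure T"
    using separable[of "{0..s}"] by blast
  have extend: "X \<omega> \<inter> (axis_ball R t0 - Q) \<noteq> {}"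
    if \<omega>: "\<omega> \<in> space M" and cov: "\<forall>t\<in>T. X \<omega> \<inter> (axis_ball R t - Q) \<noteq> {}" and t0: "t0 \<in> {0..s}" for \<omega> t0
  proof
    assume unc: "X \<omega> \<inter> (axis_ball R t0 - Q) = {}"
    obtain \<rho> where \<rho>: "\<And>t. \<bar>t - t0\<bar> \<le> 1 \<Longrightarrow> axis_ball R t \<subseteq> {z\<in>hplane. hdist z (axis_point t0) < \<rho>}"
      using axis_ball_subset_hball[of R t0] R_pos by auto
    define Z where "Z = X \<omega> \<inter> hball (axis_point t0) \<rho> - Q"
    have "finite Z"
      using poisson \<omega> axis_point_hplane by (simp add: poisson_process_def Z_def)
    define N where "N = ball t0 1 \<inter> (\<Inter>z\<in>Z. - {t. z \<in> axis_ball R t})"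
    have "open N"
      unfolding N_def using \<open>finite Z\<close> R_pos
      by (intro open_Int open_INT ballI open_ball open_Compl closed_axis_ball_times) auto
    moreover have "t0 \<in> N" using unc by (auto simp: N_def Z_def)
    moreover have "t0 \<in> closure T" using T t0 by auto
    ultimately obtain t where t: "t \<in> T" "t \<in> N"
      using closure_iff_nhds_not_empty[of t0 T] by (metis disjoint_iff order_refl)
    then obtain z where z: "z \<in> X \<omega>" "z \<in> axis_ball R t" "z \<notin> Q" using cov by blast
    have "\<bar>t - t0\<bar> \<le> 1" using t by (auto simp: N_def dist_real_def)
    then have "z \<in> Z" using z \<rho> by (auto simp: Z_def hball_def hdist_commute)
    then show False using t z by (auto simp: N_def)
  qed
  have "covered Q s = {\<omega> \<in> space M. \<forall>t\<in>T. X \<omega> \<inter> (axis_ball R t - Q) \<noteq> {}}"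
    unfolding covered_def
  proof (intro Collect_cong conj_cong refl iffI ballI)
    fix \<omega> t assume "\<forall>t\<in>{0..s}. X \<omega> \<inter> (axis_ball R t - Q) \<noteq> {}" "t \<in> T"
    then show "X \<omega> \<inter> (axis_ball R t - Q) \<noteq> {}" using T(2) by blast
  qed (rule extend)
  also have "\<dots> = space M \<inter> (\<Inter>t\<in>T. space M - void (axis_ball R t - Q))"
    by (auto simp: void_def)
  also have "\<dots> \<in> events_in W"
  proof (cases "T = {}")
    case False
    have "space M - void (axis_ball R t - Q) \<in> events_in W" if "t \<in> T" for t
      using that T(2)
      by (intro W.compl_sets void_in observable_Diff axis_ball_observable Q W) blast
    then have "(\<Inter>t\<in>T. space M - void (axis_ball R t - Q)) \<in> events_in W"
      using T(1) False by (intro W.countable_INT') auto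
    then show ?thesis by (rule W.Int[OF W.top])
  qed auto
  finally show ?thesis .
qed

lemma covered_event: "covered {} s \<in> events"
  by (rule subsetD[OF events_in_events covered_in[of "{}" s UNIV]]) auto

lemma prob_reach_void:
  assumes "p \<le> r"
  shows "prob (void (axis_ball R r - axis_ball R p)) = exp (- (l * reach_area R (r - p)))"
proof -
  have "axis_ball R r - axis_ball R p \<in> observable"
    using R_pos by (intro observable_Diff axis_ball_observable axis_ball_sets_harea) auto
  moreover have "measure harea (axis_ball R r - axis_ball R p) = reach_area R (r - p)"
    using emeasure_axis_ball_diff[OF R_pos assms] reach_area_nonneg[of R "r - p"] assms R_pos
    by (simp add: measure_def)
  ultimately show ?thesis by (simp add: prob_void)
qed

text \<open>The probability that every interval covering a given point started at least \<open>\<tau>\<close>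
before it.\<close>

definition survival :: "real \<Rightarrow> real" where
  "survival \<tau> = exp (- (l * reach_area R \<tau>))"

context
  fixes r h :: real and N :: nat
  assumes r: "r \<ge> 0" and h: "h > 0" and N: "real N * h > 2 * R"
begin

text \<open>The centres whose ball cuts an interval out of the axis that contains \<open>r\<close> and starts
after \<open>r - k h\<close>.\<close>

definition reach :: "nat \<Rightarrow> complex set" where
  "reach k = axis_ball R r - axis_ball R (r - real k * h)"

lemma reach_mono: "j \<le> k \<Longrightarrow> reach j \<subseteq> reach k"
  using axis_ball_interval[of R _ "r - real k * h" r "r - real j * h"] R_pos h
  by (auto simp: reach_def mult_right_mono)

lemma reach_0: "reach 0 = {}" and reach_N: "reach N = axis_ball R r"
  using axis_ball_far[of R r "r - real N * h"] R_pos N by (auto simp: reach_def)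

lemma reach_observable: "reach k \<in> observable"
  unfolding reach_def
  using R_pos by (intro observable_Diff axis_ball_observable axis_ball_sets_harea) auto

lemma prob_void_reach: "prob (void (reach k)) = survival (real k * h)"
  unfolding reach_def survival_def using h by (subst prob_reach_void) auto

text \<open>The youngest interval covering \<open>r\<close> has age between \<open>k h\<close> and \<open>(k +
1) h\<close>.\<close>

definition last_birth :: "nat \<Rightarrow> 'w set" where
  "last_birth k = void (reach k) - void (reach (Suc k))"

lemma last_birth_event: "last_birth k \<in> events"
  unfolding last_birth_def by (intro sets.Diff void_event reach_observable)

lemma disjoint_last_birth: "disjoint_family_on last_birth A"
proof -
  have "last_birth j \<inter> last_birth k = {}" if "j < k" for j k
    using reach_mono[of "Suc j" k] that by (auto simp: last_birth_def void_def)
  then show ?thesis by (auto simp: disjoint_family_on_def) (metis disjoint_iff linorder_neqE_nat)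
qed

lemma prob_last_birth: "prob (last_birth k) = survival (real k * h) - survival (real (Suc k) * h)"
proof -
  have "void (reach (Suc k)) \<subseteq> void (reach k)"
    using reach_mono[of k "Suc k"] by (auto simp: void_def)
  then show ?thesis
    unfolding last_birth_def
    by (subst finite_measure_Diff) (auto simp: void_event reach_observable prob_void_reach simp del: of_nat_Suc)
qed

text \<open>As intervals have length at most \<open>2 R < N h\<close>, the age of the youngest one covering
\<open>r\<close> falls into one of the first \<open>N\<close> cells.\<close>

lemma covered_subset_last_birth: "covered {} r \<subseteq> (\<Union>k<N. last_birth k)"
proof
  fix \<omega> assume \<omega>: "\<omega> \<in> covered {} r"
  have start: "\<omega> \<in> void (reach 0)"
    using \<omega> by (simp add: covered_def void_def reach_0)
  have stop: "\<omega> \<notin> void (reach N)"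
    using \<omega> r by (simp add: covered_def void_def reach_N)
  obtain k where k: "k < N" "\<omega> \<in> void (reach k)" "\<omega> \<notin> void (reach (Suc k))"
  proof (rule ccontr)
    assume *: "\<not> thesis"
    have "k \<le> N \<Longrightarrow> \<omega> \<in> void (reach k)" for k
    proof (induction k)
      case (Suc k)
      then show ?case using that[of k] * by auto
    qed (use start in simp)
    with stop show False by simp
  qed
  then show "\<omega> \<in> (\<Union>k<N. last_birth k)" by (auto simp: last_birth_def)
qed

text \<open>Rounding the age up shortens the remaining segment to \<open>[0, r - (k + 1) h]\<close>. Covering it
involves only intervals that start at \<open>r - (k + 1) h\<close> or earlier, while the age cell is decided by
those that start later and reach \<open>r\<close>.\<close>

lemma renewal_upper:
  "prob (covered {} r) \<le>
     (\<Sum>k<N. (survival (real k * h) - survival (real (Suc k) * h)) * prob (covered {} (r - real (Suc k) * h)))"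
proof -
  have *: "prob (covered {} r \<inter> last_birth k) \<le> prob (last_birth k) * prob (covered {} (r - real (Suc k) * h))" for k
  proof -
    define s where "s = r - real (Suc k) * h"
    have "s \<le> r" using h by (simp add: s_def)
    then have "covered {} r \<inter> last_birth k \<subseteq> covered {} s \<inter> last_birth k"
      by (auto simp: covered_def)
    then have "prob (covered {} r \<inter> last_birth k) \<le> prob (covered {} s \<inter> last_birth k)"
      by (intro finite_measure_mono sets.Int covered_event last_birth_event)
    also have "\<dots> = prob (covered {} s) * prob (last_birth k)"
    proof (rule prob_Int_disjoint_regions)
      show "covered {} s \<in> events_in (\<Union>t\<in>{0..s}. axis_ball R t)"
        by (rule covered_in) auto
      interpret W: sigma_algebra "space M" "events_in (reach (Suc k))" by (rule sigma_algebra_events_in)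
      show "last_birth k \<in> events_in (reach (Suc k))"
        unfolding last_birth_def by (intro W.Diff void_in reach_observable reach_mono) auto
      show "(\<Union>t\<in>{0..s}. axis_ball R t) \<inter> reach (Suc k) = {}"
        using axis_ball_interval[of R _ _ r s] R_pos h
        by (auto simp: reach_def s_def simp del: of_nat_Suc)
    qed
    finally show ?thesis by (simp add: s_def mult.commute)
  qed
  have "covered {} r = (\<Union>k<N. covered {} r \<inter> last_birth k)"
    using covered_subset_last_birth by blast
  then have "prob (covered {} r) \<le> (\<Sum>k<N. prob (covered {} r \<inter> last_birth k))"
    using finite_measure_subadditive_finite[of "{..<N}" "\<lambda>k. covered {} r \<inter> last_birth k"]
    by (auto intro: sets.Int covered_event last_birth_event)
  also have "\<dots> \<le> (\<Sum>k<N. prob (last_birth k) * prob (covered {} (r - real (Suc k) * h)))"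
    by (intro sum_mono *)
  finally show ?thesis by (simp only: prob_last_birth)
qed

text \<open>Rounding the age down asks for \<open>[0, r - k h]\<close> to be covered, which together with the
youngest interval covers \<open>[0, r]\<close>. This event is not independent of the presence of intervals in
\<open>reach (Suc k)\<close> but positively correlated with it: if they are absent, then \<open>[0, r - k
h]\<close> must be covered by the remaining intervals, an event that is independent of the absence and less
likely than the original one.\<close>

lemma renewal_lower:
  "prob (covered {} r) \<ge>
     (\<Sum>k<N. (survival (real k * h) - survival (real (Suc k) * h)) * prob (covered {} (r - real k * h)))"
proof -
  define C where "C k = covered {} (r - real k * h)" for k :: nat
  have C: "C k \<in> events" for k unfolding C_def by (rule covered_event)
  have v: "void (reach k) \<in> events" for k by (rule void_event[OF reach_observable])
  have *: "prob (last_birth k) * prob (C k) \<le> prob (C k \<inter> last_birth k)" for k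
  proof -
    define s where "s = r - real k * h"
    define Q where "Q = reach (Suc k)"
    have Q: "Q \<in> sets harea" using reach_observable by (simp add: Q_def observable_def)
    have "prob (C k \<inter> void (reach k)) = prob (C k) * prob (void (reach k))"
    proof (rule prob_Int_disjoint_regions)
      show "C k \<in> events_in (\<Union>t\<in>{0..s}. axis_ball R t)"
        unfolding C_def s_def by (rule covered_in) auto
      show "void (reach k) \<in> events_in (reach k)" by (intro void_in reach_observable) auto
      show "(\<Union>t\<in>{0..s}. axis_ball R t) \<inter> reach k = {}"
        using axis_ball_interval[of R _ _ r s] R_pos h by (auto simp: reach_def s_def)
    qed
    moreover have "prob (C k \<inter> void Q) \<le> prob (C k) * prob (void Q)"
    proof -
      \<comment> \<open>Without points in \<open>Q\<close>, covering is the same as covering by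
      centres outside \<open>Q\<close>.\<close>
      have C': "covered Q s \<in> events_in (- Q)" by (rule covered_in[OF Q]) auto
      have sub: "covered Q s \<subseteq> C k" "C k \<inter> void Q = covered Q s \<inter> void Q"
        unfolding C_def covered_def void_def s_def by blast+
      have "prob (C k \<inter> void Q) = prob (covered Q s) * prob (void Q)"
        unfolding sub(2) using C' reach_observable
        by (intro prob_Int_disjoint_regions[of _ "- Q" _ Q] void_in) (auto simp: Q_def)
      also have "\<dots> \<le> prob (C k) * prob (void Q)"
        using sub(1) C by (intro mult_right_mono finite_measure_mono) auto
      finally show ?thesis .
    qed
    moreover have vsub: "void Q \<subseteq> void (reach k)"
      using reach_mono[of k "Suc k"] by (auto simp: void_def Q_def)
    moreover have "prob (C k \<inter> last_birth k) = prob (C k \<inter> void (reach k)) - prob (C k \<inter> void Q)"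
    proof -
      have "C k \<inter> last_birth k = C k \<inter> void (reach k) - C k \<inter> void Q"
        by (auto simp: last_birth_def Q_def)
      then show ?thesis using vsub C v by (simp add: Q_def) (intro finite_measure_Diff, auto)
    qed
    ultimately have "prob (C k) * prob (void (reach k)) - prob (C k) * prob (void Q)
        \<le> prob (C k \<inter> last_birth k)" by linarith
    moreover have "prob (last_birth k) = prob (void (reach k)) - prob (void Q)"
      unfolding last_birth_def Q_def using vsub v by (intro finite_measure_Diff) (auto simp: Q_def)
    ultimately show ?thesis by (simp add: right_diff_distrib mult.commute[of _ "prob (C k)"])
  qed
  have sub: "C k \<inter> last_birth k \<subseteq> covered {} r" for k
  proof
    fix \<omega> assume \<omega>: "\<omega> \<in> C k \<inter> last_birth k"
    then obtain z where z: "z \<in> X \<omega>" "z \<in> axis_ball R r" "z \<in> axis_ball R (r - real k * h)"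
      by (auto simp: last_birth_def void_def reach_def)
    have "X \<omega> \<inter> axis_ball R t \<noteq> {}" if t: "t \<in> {0..r}" for t
    proof (cases "t \<le> r - real k * h")
      case True then show ?thesis using \<omega> t by (auto simp: C_def covered_def)
    next
      case False
      then have "z \<in> axis_ball R t" using axis_ball_interval[OF _ z(3,2), of t] t R_pos by auto
      then show ?thesis using z by auto
    qed
    then show "\<omega> \<in> covered {} r" using \<omega> by (auto simp: C_def covered_def)
  qed
  have "(\<Sum>k<N. prob (last_birth k) * prob (C k)) \<le> (\<Sum>k<N. prob (C k \<inter> last_birth k))"
    by (intro sum_mono *)
  also have "\<dots> = prob (\<Union>k<N. C k \<inter> last_birth k)"
    using disjoint_last_birth[of "{..<N}"] C last_birth_event
    by (intro finite_measure_finite_Union[symmetric]) (auto simp: disjoint_family_on_def)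
  also have "\<dots> \<le> prob (covered {} r)"
    using sub by (intro finite_measure_mono covered_event) auto
  finally show ?thesis by (simp only: prob_last_birth C_def)
qed

end
end

section \<open>Growth rates enforced by renewal inequalities\<close>

text \<open>Each step of the recursion looks back by at least \<open>h\<close>, so induction over the number of
mesh cells before \<open>r\<close> applies.\<close>

lemma exp_upper_bound_if_renewal:
  fixes F :: "real \<Rightarrow> real"
  assumes "h > 0" "\<beta> \<ge> 0" and p: "\<And>k. k < N \<Longrightarrow> p k \<ge> 0"
    and init: "\<And>r. r < 0 \<Longrightarrow> F r = 1"
    and ren: "\<And>r. r \<ge> 0 \<Longrightarrow> F r \<le> (\<Sum>k<N. p k * F (r - real (Suc k) * h))"
    and total: "(\<Sum>k<N. p k * exp (\<beta> * (real (Suc k) * h))) \<le> 1"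
  shows "F r \<le> exp (- \<beta> * r)"
proof -
  have "F r \<le> exp (- \<beta> * r)" if "r < real n * h" for n r
    using that
  proof (induction n arbitrary: r)
    case 0
    then show ?case using init \<open>\<beta> \<ge> 0\<close> by (simp add: mult_nonneg_nonpos)
  next
    case (Suc n)
    show ?case
    proof (cases "r < 0")
      case True
      then show ?thesis using init \<open>\<beta> \<ge> 0\<close> by (simp add: mult_nonneg_nonpos)
    next
      case False
      then have "F r \<le> (\<Sum>k<N. p k * F (r - real (Suc k) * h))" by (intro ren) auto
      also have "\<dots> \<le> (\<Sum>k<N. p k * exp (- \<beta> * (r - real (Suc k) * h)))"
      proof (intro sum_mono mult_left_mono Suc.IH p)
        fix k
        have "0 \<le> real k * h" using \<open>h > 0\<close> by simp
        then show "r - real (Suc k) * h < real n * h" using Suc.prems by (simp add: algebra_simps)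
      qed auto
      also have "\<dots> = exp (- \<beta> * r) * (\<Sum>k<N. p k * exp (\<beta> * (real (Suc k) * h)))"
        unfolding sum_distrib_left
        by (intro sum.cong refl) (simp add: right_diff_distrib exp_diff exp_minus divide_simps del: of_nat_Suc)
      also have "\<dots> \<le> exp (- \<beta> * r) * 1" by (intro mult_left_mono total) auto
      finally show ?thesis by simp
    qed
  qed
  moreover obtain n where "r / h < real n" using reals_Archimedean2 by blast
  ultimately show ?thesis using \<open>h > 0\<close> by (simp add: pos_divide_less_eq)
qed

text \<open>The term \<open>k = 0\<close> refers to \<open>F r\<close> itself and is moved to the other side,
which is why \<open>p 0 < 1\<close> is needed. The recursion looks back by less than \<open>N h\<close>, and on
\<open>[- N h, 0)\<close> the constant \<open>exp (- \<beta> N h)\<close> keeps the exponential below 1.\<close>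

lemma exp_lower_bound_if_renewal:
  fixes F :: "real \<Rightarrow> real"
  assumes "h > 0" "\<beta> \<ge> 0" and p: "\<And>k. k < N \<Longrightarrow> p k \<ge> 0" and "N > 0" "p 0 < 1"
    and init: "\<And>r. r < 0 \<Longrightarrow> F r = 1"
    and ren: "\<And>r. r \<ge> 0 \<Longrightarrow> (\<Sum>k<N. p k * F (r - real k * h)) \<le> F r"
    and total: "(\<Sum>k<N. p k * exp (\<beta> * (real k * h))) \<ge> 1"
    and r: "r \<ge> - (real N * h)"
  shows "exp (- \<beta> * (real N * h)) * exp (- \<beta> * r) \<le> F r"
proof -
  define c where "c = exp (- \<beta> * (real N * h))"
  have early: "c * exp (- \<beta> * r) \<le> F r" if "r \<ge> - (real N * h)" "r < 0" for r
  proof -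
    have "\<beta> * (real N * h + r) \<ge> 0" using that \<open>\<beta> \<ge> 0\<close> by (intro mult_nonneg_nonneg) auto
    then have "c * exp (- \<beta> * r) \<le> 1" by (simp add: c_def flip: exp_add) (simp add: algebra_simps)
    then show ?thesis using init that by simp
  qed
  have "c * exp (- \<beta> * r) \<le> F r" if "r < real n * h" "r \<ge> - (real N * h)" for n r
    using that
  proof (induction n arbitrary: r)
    case 0
    then show ?case using early by simp
  next
    case (Suc n)
    show ?case
    proof (cases "r < 0")
      case True
      then show ?thesis using early Suc.prems by simp
    next
      case False
      obtain N' where N': "N = Suc N'" using \<open>N > 0\<close> by (cases N) auto
      have "(1 - p 0) * (c * exp (- \<beta> * r)) \<le> 
         c * exp (- \<beta> * r) * ((\<Sum>k<N. p k * exp (\<beta> * (real k * h))) - p 0)"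
        using total by (auto simp: c_def mult.commute intro!: mult_left_mono)
      also have "\<dots> = (\<Sum>k<N'. p (Suc k) * (c * exp (- \<beta> * (r - real (Suc k) * h))))"
        unfolding N' sum.lessThan_Suc_shift sum_distrib_left
        by (simp add: sum_distrib_left del: of_nat_Suc)
           (intro sum.cong refl, simp add: right_diff_distrib exp_diff exp_minus divide_simps del: of_nat_Suc)
      also have "\<dots> \<le> (\<Sum>k<N'. p (Suc k) * F (r - real (Suc k) * h))"
      proof (intro sum_mono mult_left_mono Suc.IH p)
        fix k assume k: "k \<in> {..<N'}"
        have "0 \<le> real k * h" using \<open>h > 0\<close> by simp
        then show "r - real (Suc k) * h < real n * h" using Suc.prems by (simp add: algebra_simps)
        have "real (Suc k) * h \<le> real N * h" using k N' \<open>h > 0\<close> by (intro mult_right_mono) auto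
        then show "- (real N * h) \<le> r - real (Suc k) * h" using False by simp
      qed (auto simp: N')
      also have "\<dots> \<le> (1 - p 0) * F r"
        using ren[of r] False unfolding N' sum.lessThan_Suc_shift by (simp add: algebra_simps)
      finally show ?thesis using \<open>p 0 < 1\<close> by simp
    qed
  qed
  moreover obtain n where "r / h < real n" using reals_Archimedean2 by blast
  ultimately show ?thesis using \<open>h > 0\<close> r by (simp add: pos_divide_less_eq c_def)
qed

lemma exp_rate_le:
  assumes "c > 0" and le: "\<And>r. r \<ge> 0 \<Longrightarrow> c * exp (- a * r) \<le> exp (- b * r)"
  shows "b \<le> (a::real)"
proof (rule ccontr)
  assume "\<not> b \<le> a"
  then have "b - a > 0" by simp
  define r where "r = max 0 ((1 - ln c) / (b - a))"
  have "(b - a) * ((1 - ln c) / (b - a)) \<le> (b - a) * r"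
    using \<open>b - a > 0\<close> by (intro mult_left_mono) (auto simp: r_def)
  then have "1 - ln c \<le> (b - a) * r" using \<open>b - a > 0\<close> by simp
  then have "exp (- b * r) < exp (ln c + - a * r)" by (simp add: algebra_simps)
  also have "\<dots> = c * exp (- a * r)" using \<open>c > 0\<close> by (simp only: exp_add exp_ln)
  also have "\<dots> \<le> exp (- b * r)" by (rule le) (simp add: r_def)
  finally show False by simp
qed

section \<open>The exponent equation as a tilted mass\<close>

text \<open>On \<open>(0, 2R)\<close> this is the derivative of \<open>H R l\<close>; at the endpoints it is the
one-sided derivative, which makes it continuous on \<open>[0, 2R]\<close>.\<close>

definition cover_density :: "real \<Rightarrow> real \<Rightarrow> real \<Rightarrow> real" where
  "cover_density R l t = l * reach_rate R t * exp (- (l * reach_area R t))"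

lemma reach_area_eq_integral: "t \<le> 2 * R \<Longrightarrow> reach_area R t = integral {0..t} (reach_rate R)"
  by (simp add: reach_area_def min_def)

lemma reach_area_deriv:
  assumes "t \<in> {0..2*R}"
  shows "(reach_area R has_real_derivative reach_rate R t) (at t within {0..2*R})"
proof (rule has_field_derivative_transform_within[of _ _ _ _ 1])
  show "((\<lambda>t. integral {0..t} (reach_rate R)) has_real_derivative reach_rate R t) (at t within {0..2*R})"
    by (rule integral_has_real_derivative[OF continuous_on_reach_rate assms])
qed (use assms in \<open>auto simp: reach_area_eq_integral\<close>)

lemma survival_deriv:
  assumes "t \<in> {0..2*R}"
  shows "((\<lambda>t. - exp (- (l * reach_area R t))) has_real_derivative cover_density R l t) (at t within {0..2*R})"
  by (rule derivative_eq_intros reach_area_deriv[OF assms] refl | simp add: cover_density_def)+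

lemma continuous_on_cover_density: "continuous_on {0..2*R} (cover_density R l)"
proof -
  have "continuous_on {0..2*R} (reach_area R)"
    using reach_area_deriv DERIV_continuous continuous_on_eq_continuous_within by blast
  then show ?thesis
    unfolding cover_density_def by (intro continuous_intros continuous_on_reach_rate)
qed

lemma H_eq: 
  assumes "t \<in> {0..2*R}"
  shows "H R l t = - exp (- (l * reach_area R t))"
proof -
  have "((\<lambda>v. sinh (arcosh (cosh R / cosh v))) has_integral integral {0..t/2} (\<lambda>s. sinh (arcosh (cosh R / cosh s)))) {0..t/2}"
    using cosh_quotient_ge_1[of _ R] assms
    by (intro integrable_integral integrable_continuous_real continuous_intros) auto
  from has_integral_stretch_real[OF this, of "1/2"]
  have "((\<lambda>v. sinh (arcosh (cosh R / cosh (v/2)))) has_integral 2 * integral {0..t/2} (\<lambda>s. sinh (arcosh (cosh R / cosh s)))) {0..t}"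
    using assms image_mult_atLeastAtMost[of 2 0 "t/2"] by (simp add: mult.commute)
  from has_integral_mult_right[OF this, of 2]
  have "integral {0..t} (reach_rate R) = 4 * integral {0..t/2} (\<lambda>s. sinh (arcosh (cosh R / cosh s)))"
    by (intro integral_unique) (simp add: reach_rate_def[abs_def])
  then show ?thesis using assms by (simp add: H_def reach_area_eq_integral)
qed

lemma deriv_H:
  assumes "t \<in> {0<..<2*R}"
  shows "deriv (H R l) t = cover_density R l t"
proof (rule DERIV_imp_deriv)
  have "at t within {0..2*R} = at t"
    using assms by (intro at_within_Icc_at) auto
  then have "((\<lambda>t. - exp (- (l * reach_area R t))) has_real_derivative cover_density R l t) (at t)"
    using survival_deriv[of t R l] assms by (metis atLeastAtMost_iff greaterThanLessThan_iff less_imp_le)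
  then show "(H R l has_real_derivative cover_density R l t) (at t)"
  proof (rule has_field_derivative_transform_within_open)
    show "t \<in> {0<..<2*R}" by fact
    show "- exp (- (l * reach_area R x)) = H R l x" if "x \<in> {0<..<2*R}" for x
      using that by (subst H_eq) auto
  qed simp
qed

definition tilted_mass :: "real \<Rightarrow> real \<Rightarrow> real \<Rightarrow> real" where
  "tilted_mass R l \<beta> = integral {0..2*R} (\<lambda>t. exp (\<beta> * t) * cover_density R l t)"

lemma exponent_equation_iff: "exponent_equation R l \<beta> \<longleftrightarrow> tilted_mass R l \<beta> = 1"
proof -
  have "integral {0..2*R} (\<lambda>t. exp (\<beta> * t) * deriv (H R l) t) = tilted_mass R l \<beta>"
    unfolding tilted_mass_def
    by (rule integral_spike[of "{0, 2*R}"]) (auto simp: deriv_H)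
  then show ?thesis by (auto simp: exponent_equation_def)
qed

lemma cover_density_nonneg: "l > 0 \<Longrightarrow> t \<in> {0..2*R} \<Longrightarrow> cover_density R l t \<ge> 0"
  by (simp add: cover_density_def reach_rate_nonneg)

lemma tilted_integrable: "{a..b} \<subseteq> {0..2*R} \<Longrightarrow> (\<lambda>t. exp (\<beta> * t) * cover_density R l t) integrable_on {a..b}"
  by (intro integrable_continuous_real continuous_intros continuous_on_subset[OF continuous_on_cover_density])

lemma cover_density_integral:
  assumes "0 \<le> a" "a \<le> b" "b \<le> 2 * R"
  shows "(cover_density R l has_integral exp (- (l * reach_area R a)) - exp (- (l * reach_area R b))) {a..b}"
proof -
  have "((\<lambda>t. - exp (- (l * reach_area R t))) has_vector_derivative cover_density R l t) (at t within {a..b})"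
    if "t \<in> {a..b}" for t
    using DERIV_subset[OF survival_deriv[of t R l], of "{a..b}"] that assms
    by (auto simp: has_real_derivative_iff_has_vector_derivative)
  from fundamental_theorem_of_calculus[OF assms(2) this] show ?thesis by simp
qed

text \<open>Without tilt the mass is the probability that a point is covered at all.\<close>

lemma tilted_mass_0: "R > 0 \<Longrightarrow> tilted_mass R l 0 < 1"
  using integral_unique[OF cover_density_integral[of 0 "2*R" R l]] 
  by (simp add: tilted_mass_def reach_area_def)

text \<open>A quantitative form of continuity in the tilt, from \<open>t \<le> 2R\<close>.\<close>

lemma tilted_mass_shift:
  assumes "l > 0" "\<delta> \<ge> 0"
  shows "tilted_mass R l (\<beta> + \<delta>) \<le> exp (2 * R * \<delta>) * tilted_mass R l \<beta>"
proof -
  have "tilted_mass R l (\<beta> + \<delta>) \<le> integral {0..2*R} (\<lambda>t. exp (2 * R * \<delta>) * (exp (\<beta> * t) * cover_density R l t))"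
    unfolding tilted_mass_def
  proof (rule integral_le)
    show "(\<lambda>t. exp ((\<beta> + \<delta>) * t) * cover_density R l t) integrable_on {0..2*R}"
      by (rule tilted_integrable) simp
    show "(\<lambda>t. exp (2 * R * \<delta>) * (exp (\<beta> * t) * cover_density R l t)) integrable_on {0..2*R}"
      by (intro integrable_continuous_real continuous_intros continuous_on_cover_density)
    fix t assume t: "t \<in> {0..2*R}"
    have "t * \<delta> \<le> 2 * R * \<delta>" using t assms by (intro mult_right_mono) auto
    then have "exp ((\<beta> + \<delta>) * t) \<le> exp (2 * R * \<delta>) * exp (\<beta> * t)"
      by (simp flip: exp_add) (simp add: algebra_simps)
    then show "exp ((\<beta> + \<delta>) * t) * cover_density R l t \<le> exp (2 * R * \<delta>) * (exp (\<beta> * t) * cover_density R l t)"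
      using cover_density_nonneg[OF assms(1) t] by (metis mult.assoc mult_right_mono)
  qed
  then show ?thesis by (simp add: tilted_mass_def)
qed

lemma tilted_mass_strict_mono:
  assumes "l > 0" "R > 0" "\<beta> < \<beta>'"
  shows "tilted_mass R l \<beta> < tilted_mass R l \<beta>'"
proof -
  define f where "f t = exp (\<beta>' * t) * cover_density R l t - exp (\<beta> * t) * cover_density R l t" for t
  have f: "continuous_on {0..2*R} f"
    unfolding f_def by (intro continuous_intros continuous_on_cover_density)
  have nonneg: "f t \<ge> 0" if "t \<in> {0..2*R}" for t
    using that assms cover_density_nonneg[OF assms(1) that]
    by (auto simp: f_def left_diff_distrib[symmetric] intro!: mult_nonneg_nonneg mult_right_mono)
  have "cosh (R/2) < cosh R" using assms by (subst cosh_real_nonneg_less_iff) auto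
  then have "cover_density R l R > 0"
    using assms by (auto simp: cover_density_def reach_rate_def intro!: mult_pos_pos)
  then have "f R > 0" using assms by (simp add: f_def left_diff_distrib[symmetric])
  then have "integral {0..2*R} f \<noteq> 0"
    using integral_eq_0_iff[OF f] nonneg assms by force
  moreover have "integral {0..2*R} f \<ge> 0"
    by (rule integral_nonneg[OF integrable_continuous_real[OF f]]) (use nonneg in auto)
  moreover have "integral {0..2*R} f = tilted_mass R l \<beta>' - tilted_mass R l \<beta>"
    unfolding f_def tilted_mass_def by (intro integral_diff tilted_integrable) auto
  ultimately show ?thesis by linarith
qed

text \<open>On each cell the density integrates to \<open>p k\<close> and \<open>e\<^sup>\<beta>\<^sup>t\<close>
lies between its values at the two ends.\<close>

lemma tilted_mass_partition:
  assumes "l > 0" "R > 0" "\<beta> \<ge> 0" "N > 0" and h: "h = 2 * R / real N"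
  defines "p \<equiv> \<lambda>k. exp (- (l * reach_area R (real k * h))) - exp (- (l * reach_area R (real (Suc k) * h)))"
  shows "(\<Sum>k<N. p k * exp (\<beta> * (real k * h))) \<le> tilted_mass R l \<beta>"
    and "tilted_mass R l \<beta> \<le> (\<Sum>k<N. p k * exp (\<beta> * (real (Suc k) * h)))"
proof -
  have h0: "h > 0" and Nh: "real N * h = 2 * R" using assms by auto
  have step: "real k * h \<le> real (Suc k) * h" for k using h0 by (intro mult_right_mono) auto
  have le: "real k * h \<le> 2 * R" if "k \<le> N" for k
    using that h0 Nh by (metis mult_right_mono of_nat_le_iff less_imp_le)
  define g where "g t = exp (\<beta> * t) * cover_density R l t" for t
  have cells: "integral {0..real n * h} g = (\<Sum>k<n. integral {real k * h..real (Suc k) * h} g)" if "n \<le> N" for n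
    using that
  proof (induction n)
    case (Suc n)
    have "integral {0..real n * h} g + integral {real n * h..real (Suc n) * h} g = integral {0..real (Suc n) * h} g"
    proof (rule Henstock_Kurzweil_Integration.integral_combine)
      show "g integrable_on {0..real (Suc n) * h}"
        unfolding g_def using le[OF Suc.prems] by (intro tilted_integrable) auto
    qed (use h0 step in auto)
    then show ?case using Suc by simp
  qed simp
  have total: "tilted_mass R l \<beta> = (\<Sum>k<N. integral {real k * h..real (Suc k) * h} g)"
    using cells[of N] by (simp add: tilted_mass_def g_def[abs_def] Nh)
  have cell: "p k * exp (\<beta> * (real k * h)) \<le> integral {real k * h..real (Suc k) * h} g \<and>
      integral {real k * h..real (Suc k) * h} g \<le> p k * exp (\<beta> * (real (Suc k) * h))"
    if k: "k < N" for k
  proof (rule conjI)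
    have sub: "{real k * h..real (Suc k) * h} \<subseteq> {0..2*R}"
      using le[of "Suc k"] k h0 by (auto intro: order_trans)
    have I: "(cover_density R l has_integral p k) {real k * h..real (Suc k) * h}"
      unfolding p_def using le[of "Suc k"] k h0 step by (intro cover_density_integral) auto
    have G: "(g has_integral integral {real k * h..real (Suc k) * h} g) {real k * h..real (Suc k) * h}"
      unfolding g_def by (intro integrable_integral tilted_integrable sub)
    show "p k * exp (\<beta> * (real k * h)) \<le> integral {real k * h..real (Suc k) * h} g"
    proof (rule has_integral_le[OF has_integral_mult_left[OF I] G])
      fix t assume t: "t \<in> {real k * h..real (Suc k) * h}"
      then show "cover_density R l t * exp (\<beta> * (real k * h)) \<le> g t"
        using cover_density_nonneg[OF assms(1), of t R] sub assms(3)
        by (auto simp: g_def mult.commute[of _ "cover_density R l t"] intro!: mult_left_mono)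
    qed
    show "integral {real k * h..real (Suc k) * h} g \<le> p k * exp (\<beta> * (real (Suc k) * h))"
    proof (rule has_integral_le[OF G has_integral_mult_left[OF I]])
      fix t assume t: "t \<in> {real k * h..real (Suc k) * h}"
      then show "g t \<le> cover_density R l t * exp (\<beta> * (real (Suc k) * h))"
        using cover_density_nonneg[OF assms(1), of t R] sub assms(3)
        by (auto simp: g_def mult.commute[of _ "cover_density R l t"] simp del: of_nat_Suc intro!: mult_left_mono)
    qed
  qed
  then show "(\<Sum>k<N. p k * exp (\<beta> * (real k * h))) \<le> tilted_mass R l \<beta>"
    and "tilted_mass R l \<beta> \<le> (\<Sum>k<N. p k * exp (\<beta> * (real (Suc k) * h)))"
    unfolding total by (auto intro!: sum_mono simp del: of_nat_Suc)
qed

section \<open>Matching the decay exponent with the tilt of mass one\<close>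

context axis_cover
begin

lemma covered_negative: "r < 0 \<Longrightarrow> prob (covered {} r) = 1"
  by (simp add: covered_def prob_space)

lemma cover_prob_axis:
  "cover_prob M X R (axis_point ` {0..r}) = prob (covered {} r)"
proof -
  have "axis_point t \<in> occupied (X \<omega>) R \<longleftrightarrow> X \<omega> \<inter> axis_ball R t \<noteq> {}" if "\<omega> \<in> space M" for \<omega> t
  proof -
    have "X \<omega> \<subseteq> hplane" using poisson that by (simp add: poisson_process_def)
    then show ?thesis
      using axis_in_closure_hball[of _ R t] R_pos by (auto simp: occupied_def)
  qed
  then have "{\<omega> \<in> space M. axis_point ` {0..r} \<subseteq> occupied (X \<omega>) R} = covered {} r"
    by (auto simp: covered_def)
  then show ?thesis by (simp add: cover_prob_def)
qed

definition cell_prob :: "real \<Rightarrow> nat \<Rightarrow> real" where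
  "cell_prob h k = survival (real k * h) - survival (real (Suc k) * h)"

lemma survival_antimono:
  assumes "a \<le> b"
  shows "survival b \<le> survival a"
proof -
  have "reach_area R a \<le> reach_area R b"
    using assms reach_rate_nonneg
    by (intro has_integral_subset_le[OF _ reach_area_has_integral reach_area_has_integral]) auto
  then show ?thesis using l_pos by (simp add: survival_def)
qed

lemma cell_prob_nonneg: "h > 0 \<Longrightarrow> cell_prob h k \<ge> 0"
  unfolding cell_prob_def diff_ge_0_iff_ge by (intro survival_antimono mult_right_mono) auto

lemma cell_prob_0: "cell_prob h 0 < 1"
  using R_pos by (simp add: cell_prob_def survival_def reach_area_def)

text \<open>The mesh divides \<open>2R\<close> exactly, so that the cells partition the domain of integration;
an extra cell makes \<open>N h\<close> exceed \<open>2R\<close> strictly, and it carries no mass.\<close>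

lemma cell_prob_beyond:
  assumes "N > 0" "h = 2 * R / real N"
  shows "cell_prob h N = 0"
proof -
  have "h > 0" "real N * h = 2 * R" using assms R_pos by auto
  then have "2 * R \<le> real N * h" "2 * R \<le> real (Suc N) * h" by (auto simp: distrib_right)
  then show ?thesis by (simp add: cell_prob_def survival_def reach_area_def min_absorb2 del: of_nat_Suc)
qed

text \<open>Since the tilted mass is strictly below 1, it still is after the loss of
\<open>e\<^sup>\<beta>\<^sup>h\<close> caused by a sufficiently fine mesh.\<close>

lemma cover_upper_bound:
  assumes "\<beta> \<ge> 0" "tilted_mass R l \<beta> < 1"
  shows "prob (covered {} r) \<le> exp (- \<beta> * r)"
proof -
  have "tilted_mass R l \<beta> \<ge> 0"
    unfolding tilted_mass_def using cover_density_nonneg[OF l_pos]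
    by (intro integral_nonneg tilted_integrable) auto
  have "((\<lambda>N. exp (\<beta> * (2 * R / real N)) * tilted_mass R l \<beta>) \<longlongrightarrow> exp (\<beta> * 0) * tilted_mass R l \<beta>) sequentially"
    by (intro tendsto_intros lim_const_over_n)
  then have "\<forall>\<^sub>F N in sequentially. exp (\<beta> * (2 * R / real N)) * tilted_mass R l \<beta> < 1"
    using assms(2) by (intro order_tendstoD) auto
  then have "\<forall>\<^sub>F N in sequentially. exp (\<beta> * (2 * R / real N)) * tilted_mass R l \<beta> < 1 \<and> N > 0"
    by (intro eventually_conj eventually_gt_at_top)
  then obtain N where N: "exp (\<beta> * (2 * R / real N)) * tilted_mass R l \<beta> < 1" "N > 0"
    by (auto simp: eventually_sequentially)
  define h where "h = 2 * R / real N"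
  have h: "h > 0" "real N * h = 2 * R" using N R_pos by (auto simp: h_def)
  show ?thesis
  proof (rule exp_upper_bound_if_renewal[where h = h and N = "Suc N" and p = "cell_prob h"])
    fix s :: real assume "s \<ge> 0"
    then show "prob (covered {} s) \<le> (\<Sum>k<Suc N. cell_prob h k * prob (covered {} (s - real (Suc k) * h)))"
      unfolding cell_prob_def using h by (intro renewal_upper) (auto simp: algebra_simps)
  next
    have "(\<Sum>k<Suc N. cell_prob h k * exp (\<beta> * (real (Suc k) * h))) =
       exp (\<beta> * h) * (\<Sum>k<N. cell_prob h k * exp (\<beta> * (real k * h)))"
      unfolding sum.lessThan_Suc cell_prob_beyond[OF N(2) h_def] sum_distrib_left
      by (simp add: algebra_simps exp_add)
    also have "\<dots> \<le> exp (\<beta> * h) * tilted_mass R l \<beta>"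
      using tilted_mass_partition(1)[OF l_pos R_pos assms(1) N(2) h_def]
      by (intro mult_left_mono) (auto simp: cell_prob_def survival_def)
    also have "\<dots> \<le> 1" using N(1) by (simp add: h_def)
    finally show "(\<Sum>k<Suc N. cell_prob h k * exp (\<beta> * (real (Suc k) * h))) \<le> 1" .
  qed (use assms h cell_prob_nonneg covered_negative in auto)
qed

lemma cover_lower_bound:
  assumes "\<beta> \<ge> 0" "tilted_mass R l \<beta> > 1"
  shows "\<exists>c>0. \<forall>r\<ge>0. c * exp (- \<beta> * r) \<le> prob (covered {} r)"
proof -
  have "((\<lambda>N. exp (- (\<beta> * (2 * R / real N))) * tilted_mass R l \<beta>) \<longlongrightarrow> exp (- (\<beta> * 0)) * tilted_mass R l \<beta>) sequentially"
    by (intro tendsto_intros lim_const_over_n)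
  then have "\<forall>\<^sub>F N in sequentially. exp (- (\<beta> * (2 * R / real N))) * tilted_mass R l \<beta> > 1"
    using assms(2) by (intro order_tendstoD) auto
  then have "\<forall>\<^sub>F N in sequentially. exp (- (\<beta> * (2 * R / real N))) * tilted_mass R l \<beta> > 1 \<and> N > 0"
    by (intro eventually_conj eventually_gt_at_top)
  then obtain N where N: "exp (- (\<beta> * (2 * R / real N))) * tilted_mass R l \<beta> > 1" "N > 0"
    by (auto simp: eventually_sequentially)
  define h where "h = 2 * R / real N"
  have h: "h > 0" "real N * h = 2 * R" using N R_pos by (auto simp: h_def)
  have "exp (- \<beta> * (real (Suc N) * h)) * exp (- \<beta> * r) \<le> prob (covered {} r)" if "r \<ge> 0" for r
  proof (rule exp_lower_bound_if_renewal[where h = h and N = "Suc N" and p = "cell_prob h" and F = "\<lambda>r. prob (covered {} r)"])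
    fix s :: real assume "s \<ge> 0"
    then show "(\<Sum>k<Suc N. cell_prob h k * prob (covered {} (s - real k * h))) \<le> prob (covered {} s)"
      unfolding cell_prob_def using h by (intro renewal_lower) (auto simp: algebra_simps)
  next
    have "1 \<le> exp (- (\<beta> * h)) * tilted_mass R l \<beta>" using N(1) by (simp add: h_def)
    also have "\<dots> \<le> exp (- (\<beta> * h)) * (\<Sum>k<N. cell_prob h k * exp (\<beta> * (real (Suc k) * h)))"
      using tilted_mass_partition(2)[OF l_pos R_pos assms(1) N(2) h_def]
      by (intro mult_left_mono) (auto simp: cell_prob_def survival_def)
    also have "\<dots> = (\<Sum>k<N. cell_prob h k * exp (\<beta> * (real k * h)))"
      unfolding sum_distrib_left by (intro sum.cong refl) (simp add: algebra_simps exp_add exp_minus)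
    also have "\<dots> = (\<Sum>k<Suc N. cell_prob h k * exp (\<beta> * (real k * h)))"
      by (simp add: cell_prob_beyond[OF N(2) h_def])
    finally show "1 \<le> (\<Sum>k<Suc N. cell_prob h k * exp (\<beta> * (real k * h)))" .
    have "0 \<le> real (Suc N) * h" using h by simp
    then show "- (real (Suc N) * h) \<le> r" using that by linarith
  qed (use assms h cell_prob_nonneg cell_prob_0 covered_negative in auto)
  then show ?thesis by (intro exI[of _ "exp (- \<beta> * (real (Suc N) * h))"]) auto
qed

text \<open>If the tilted mass at \<open>\<alpha>\<close> were below 1, it would still be at \<open>\<alpha> +
\<delta>\<close>, and covering would decay faster than the lower bound of the exponent permits. If it were above
1, then \<open>\<alpha> > 0\<close>, because the untilted mass is less than 1, and at \<open>\<alpha> -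
\<delta>\<close> covering would decay too slowly for the upper bound.\<close>

lemma decay_exponent_tilted_mass:
  assumes "is_decay_exponent M X R \<alpha>"
  shows "tilted_mass R l \<alpha> = 1"
proof -
  obtain c where \<alpha>: "\<alpha> \<ge> 0" and c: "c > 0"
    and bounds: "\<And>r. r \<ge> 0 \<Longrightarrow> c * exp (- \<alpha> * r) \<le> prob (covered {} r) \<and> prob (covered {} r) \<le> exp (- \<alpha> * r)"
    using assms geodesic_segment_axis unfolding is_decay_exponent_def cover_prob_axis[symmetric] by blast
  have upper: "\<beta> \<le> \<alpha>" if "\<beta> \<ge> 0" "tilted_mass R l \<beta> < 1" for \<beta>
  proof (rule exp_rate_le[OF c])
    fix r :: real assume "r \<ge> 0"
    then show "c * exp (- \<alpha> * r) \<le> exp (- \<beta> * r)"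
      using bounds[of r] cover_upper_bound[OF that, of r] by linarith
  qed
  have lower: "\<alpha> \<le> \<beta>" if \<beta>: "\<beta> \<ge> 0" "tilted_mass R l \<beta> > 1" for \<beta>
  proof -
    obtain d where d: "d > 0" "\<And>r. r \<ge> 0 \<Longrightarrow> d * exp (- \<beta> * r) \<le> prob (covered {} r)"
      using cover_lower_bound[OF \<beta>] by blast
    show ?thesis
    proof (rule exp_rate_le[OF d(1)])
      fix r :: real assume "r \<ge> 0"
      then show "d * exp (- \<beta> * r) \<le> exp (- \<alpha> * r)" using bounds[of r] d(2)[of r] by linarith
    qed
  qed
  have small: "((\<lambda>\<delta>. exp (2 * R * \<delta>) * m) \<longlongrightarrow> m) (at_right 0)" for m
    by (auto intro!: tendsto_eq_intros)
  show ?thesis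
  proof (rule ccontr)
    assume "tilted_mass R l \<alpha> \<noteq> 1"
    then consider "tilted_mass R l \<alpha> < 1" | "tilted_mass R l \<alpha> > 1" by linarith
    then show False
    proof cases
      case 1
      have "\<forall>\<^sub>F \<delta> in at_right 0. exp (2 * R * \<delta>) * tilted_mass R l \<alpha> < 1 \<and> \<delta> > 0"
        using order_tendstoD(2)[OF small 1] by (intro eventually_conj eventually_at_right_less)
      then obtain \<delta> where \<delta>: "\<delta> > 0" "exp (2 * R * \<delta>) * tilted_mass R l \<alpha> < 1"
        using eventually_happens' trivial_limit_at_right_real by blast
      then have "tilted_mass R l (\<alpha> + \<delta>) < 1"
        using tilted_mass_shift[OF l_pos, of \<delta> R \<alpha>] by simp
      from upper[OF _ this] \<alpha> \<delta> show False by simp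
    next
      case 2
      have "\<alpha> \<noteq> 0" using tilted_mass_0[OF R_pos, of l] 2 by auto
      have "((\<lambda>\<delta>. exp (2 * R * \<delta>) * 1) \<longlongrightarrow> 1) (at_right 0)" by (rule small)
      from order_tendstoD(2)[OF this 2]
      have "\<forall>\<^sub>F \<delta> in at_right 0. exp (2 * R * \<delta>) * 1 < tilted_mass R l \<alpha> \<and> \<delta> > 0 \<and> \<delta> < \<alpha>"
        using \<alpha> \<open>\<alpha> \<noteq> 0\<close>
        by (intro eventually_conj eventually_at_right_less order_tendstoD(2)[OF tendsto_ident_at]) auto
      then obtain \<delta> where \<delta>: "\<delta> > 0" "\<delta> < \<alpha>" "exp (2 * R * \<delta>) < tilted_mass R l \<alpha>"
        using eventually_happens'[OF trivial_limit_at_right_real] by (auto simp only: mult_1_right)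
      have "tilted_mass R l \<alpha> \<le> exp (2 * R * \<delta>) * tilted_mass R l (\<alpha> - \<delta>)"
        using tilted_mass_shift[OF l_pos, of \<delta> R "\<alpha> - \<delta>"] \<delta>(1) by simp
      with \<delta>(3) have "exp (2 * R * \<delta>) < exp (2 * R * \<delta>) * tilted_mass R l (\<alpha> - \<delta>)"
        by linarith
      then have "tilted_mass R l (\<alpha> - \<delta>) > 1" by simp
      from lower[OF _ this] \<delta> show False by simp
    qed
  qed
qed

end

theorem lemma4p4:
  fixes M :: "'w measure" and X :: "'w \<Rightarrow> complex set" and l R \<alpha> :: real
  assumes "l > 0" and "R > 0"
    and "poisson_process M X l"
    and "is_decay_exponent M X R \<alpha>"
  shows "exponent_equation R l \<alpha> \<and> (\<forall>\<beta>. exponent_equation R l \<beta> \<longrightarrow> \<beta> = \<alpha>)"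
proof -
  interpret axis_cover M X l R using assms by unfold_locales
  have eq: "tilted_mass R l \<alpha> = 1" by (rule decay_exponent_tilted_mass[OF assms(4)])
  have "\<beta> = \<alpha>" if \<beta>: "tilted_mass R l \<beta> = 1" for \<beta>
  proof (cases \<beta> \<alpha> rule: linorder_cases)
    case less
    show ?thesis using tilted_mass_strict_mono[OF assms(1,2) less] eq \<beta> by linarith
  next
    case greater
    show ?thesis using tilted_mass_strict_mono[OF assms(1,2) greater] eq \<beta> by linarith
  qed
  with eq show ?thesis unfolding exponent_equation_iff by blast
qed

end
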